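(* Let $X_1,\ldots,X_n$ be an i.i.d. sample with compactly supported density $f_A\in B_{spq}(\mathbb{R}^d)$, let the scaling function $\varphi$ be compactly supported, and let $j\ge0$. Let $C_j=C_j(f_A)$ be the wavelet contrast and $\hat C_j=\hat C_j(X_1,\ldots,X_n)$ its estimator. Then the quadratic risk $E^n_{f_A}(\hat C_j-C_j)^2$ and the bias $E^n_{f_A}\hat C_j-C_j$ have convergence rate $2^{jd}\,O(1/n)$. In corollary, the variance $E^n_{f_A}\bigl(\hat C_j-E^n_{f_A}\hat C_j\bigr)^2$ has convergence rate $2^{jd}\,O(1/n)$, and the quadratic risk around zero is $E^n_{f_A}\hat C_j^2=C_j^2+2^{jd}\,O(1/n)$. Here the constants implied in $O(1/n)$ do not depend on $n$ or $j$.
   Context: Setting (independent component analysis): $X=AS$, where $A$ is an invertible $d\times d$ matrix and $S$ has density $f$ on $\mathbb{R}^d$ equal to the product of its marginals; $X$ has density $f_A(x)=|\det A^{-1}|f(A^{-1}x)$; $X_1,\ldots,X_n$ are i.i.d. copies of $X$, $X_i=(X_i^1,\ldots,X_i^d)$, and $E^n_{f_A}$ is expectation under their joint law. $B_{spq}(\mathbb{R}^d)$ is the inhomogeneous Besov space ($s>0$, $1\le p,q\le\infty$). The density is supposed to be supported in the hypercube, so that the number of indices $k\in\mathbb{Z}^d$ with nonzero coefficients at level $j$ is of order $2^{jd}$. $\varphi$ is the (real, compactly supported) scaling function of a multiresolution analysis of $L_2(\mathbb{R})$; $\varphi_{jk}(x)=2^{j/2}\varphi(2^jx-k)$ for $k\in\mathbb{Z}$;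 $\Phi_{jk}(x)=\prod_{\ell=1}^d\varphi_{jk^\ell}(x^\ell)$ for $k=(k^1,\ldots,k^d)\in\mathbb{Z}^d$. With $f_A^{\star\ell}$ the $\ell$-th one-dimensional marginal of $f_A$: $\alpha_{jk}=\int_{\mathbb{R}^d} f_A\Phi_{jk}$, $\alpha_{jk^\ell}=\int_{\mathbb{R}}f_A^{\star\ell}\varphi_{jk^\ell}$, and $C_j(f_A)=\sum_{k\in\mathbb{Z}^d}(\alpha_{jk}-\alpha_{jk^1}\cdots\alpha_{jk^d})^2$. The estimators are $\hat\alpha_{jk}=\frac1n\sum_{i=1}^n\varphi_{jk^1}(X_i^1)\cdots\varphi_{jk^d}(X_i^d)$, $\hat\alpha_{jk^\ell}=\frac1n\sum_{i=1}^n\varphi_{jk^\ell}(X_i^\ell)$ and $\hat C_j=\sum_{k\in\mathbb{Z}^d}(\hat\alpha_{jk}-\hat\alpha_{jk^1}\cdots\hat\alpha_{jk^d})^2$.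
   Formalization: The density f_A is also assumed to lie in L_2(R^d) and the scaling function to be bounded; the rates for the quadratic risk, the variance and the risk around zero are claimed only when 2^{jd} ≤ n (the bias for all n ≥ 1, j ≥ 0). Without these the statement is false. *)

theory Defs
  imports "HOL-Probability.Probability"
begin

text \<open>The space of square-integrable functions is represented by functions, not by classes modulo
  null sets. The closedness clause below makes every \<open>V j\<close> saturated under almost-everywhere
  equality.\<close>

definition square_integrable :: "('a::euclidean_space \<Rightarrow> real) \<Rightarrow> bool" where
  "square_integrable f \<longleftrightarrow> f \<in> borel_measurable lborel \<and> integrable lborel (\<lambda>x. (f x)\<^sup>2)"

definition sq_dist :: "('a::euclidean_space \<Rightarrow> real) \<Rightarrow> ('a \<Rightarrow> real) \<Rightarrow> real" where
  "sq_dist f g = (LINT x|lborel. (f x - g x)\<^sup>2)"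

definition closed_L2_subspace :: "(real \<Rightarrow> real) set \<Rightarrow> bool" where
  "closed_L2_subspace V \<longleftrightarrow>
     (\<forall>f\<in>V. square_integrable f) \<and>
     (\<lambda>x. 0) \<in> V \<and>
     (\<forall>f\<in>V. \<forall>g\<in>V. \<forall>a b. (\<lambda>x. a * f x + b * g x) \<in> V) \<and>
     (\<forall>f. square_integrable f \<and> (\<forall>\<epsilon>>0. \<exists>g\<in>V. sq_dist f g < \<epsilon>) \<longrightarrow> f \<in> V)"

definition orthonormal_basis_of_translates :: "(real \<Rightarrow> real) set \<Rightarrow> (real \<Rightarrow> real) \<Rightarrow> bool" where
  "orthonormal_basis_of_translates V \<phi> \<longleftrightarrow>
     (\<forall>k::int. (\<lambda>x. \<phi> (x - of_int k)) \<in> V) \<and>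
     (\<forall>k l::int. (LINT x|lborel. \<phi> (x - of_int k) * \<phi> (x - of_int l)) = (if k = l then 1 else 0)) \<and>
     (\<forall>f\<in>V. \<forall>\<epsilon>>0. \<exists>(F::int set) c. finite F \<and>
        sq_dist f (\<lambda>x. \<Sum>k\<in>F. c k * \<phi> (x - of_int k)) < \<epsilon>)"

definition multiresolution_analysis :: "(int \<Rightarrow> (real \<Rightarrow> real) set) \<Rightarrow> (real \<Rightarrow> real) \<Rightarrow> bool" where
  "multiresolution_analysis V \<phi> \<longleftrightarrow>
     (\<forall>j. closed_L2_subspace (V j)) \<and>
     (\<forall>j. V j \<subseteq> V (j + 1)) \<and>
     (\<forall>j f. f \<in> V j \<longleftrightarrow> (\<lambda>x. f (2 * x)) \<in> V (j + 1)) \<and>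
     (\<forall>f. (\<forall>j. f \<in> V j) \<longrightarrow> (AE x in lborel. f x = 0)) \<and>
     (\<forall>f. square_integrable f \<longrightarrow> (\<forall>\<epsilon>>0. \<exists>j. \<exists>g\<in>V j. sq_dist f g < \<epsilon>)) \<and>
     orthonormal_basis_of_translates (V 0) \<phi>"

definition scaling_function :: "(real \<Rightarrow> real) \<Rightarrow> bool" where
  "scaling_function \<phi> \<longleftrightarrow> (\<exists>V. multiresolution_analysis V \<phi>)"

definition compactly_supported :: "('a::euclidean_space \<Rightarrow> real) \<Rightarrow> bool" where
  "compactly_supported f \<longleftrightarrow> compact (closure {x. f x \<noteq> 0})"

text \<open>The exponents \<open>p\<close> and \<open>q\<close> range over \<open>[1, \<infinity>]\<close> in \<^typ>\<open>ennreal\<close>; the value \<open>\<top>\<close> stands for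
  infinity and then \<^term>\<open>enn2real\<close> is not used.\<close>

definition ennreal_power :: "ennreal \<Rightarrow> real \<Rightarrow> ennreal" where
  "ennreal_power x a = (if x = \<top> then \<top> else ennreal (enn2real x powr a))"

definition Lp_norm :: "ennreal \<Rightarrow> ('a::euclidean_space \<Rightarrow> real) \<Rightarrow> ennreal" where
  "Lp_norm p f =
     (if p = \<top> then esssup lborel (\<lambda>x. ennreal \<bar>f x\<bar>)
      else ennreal_power (\<integral>\<^sup>+ x. ennreal (\<bar>f x\<bar> powr enn2real p) \<partial>lborel) (1 / enn2real p))"

definition finite_difference :: "nat \<Rightarrow> 'a::euclidean_space \<Rightarrow> ('a \<Rightarrow> real) \<Rightarrow> 'a \<Rightarrow> real" where
  "finite_difference r h f x =
     (\<Sum>i\<le>r. (-1) ^ (r - i) * real (r choose i) * f (x + real i *\<^sub>R h))"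

definition modulus_of_smoothness ::
    "nat \<Rightarrow> ennreal \<Rightarrow> ('a::euclidean_space \<Rightarrow> real) \<Rightarrow> real \<Rightarrow> ennreal" where
  "modulus_of_smoothness r p f t = (SUP h\<in>{h. norm h \<le> t}. Lp_norm p (finite_difference r h f))"

definition besov_seminorm ::
    "real \<Rightarrow> ennreal \<Rightarrow> ennreal \<Rightarrow> ('a::euclidean_space \<Rightarrow> real) \<Rightarrow> ennreal" where
  "besov_seminorm s p q f =
     (let r = nat \<lfloor>s\<rfloor> + 1;
          w = (\<lambda>t. ennreal (t powr (- s)) * modulus_of_smoothness r p f t)
      in if q = \<top> then (SUP t\<in>{0<..}. w t)
         else ennreal_power
           (\<integral>\<^sup>+ t\<in>{0<..}. ennreal_power (w t) (enn2real q) * ennreal (1 / t) \<partial>lborel)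
           (1 / enn2real q))"

definition besov_space :: "real \<Rightarrow> ennreal \<Rightarrow> ennreal \<Rightarrow> ('a::euclidean_space \<Rightarrow> real) set" where
  "besov_space s p q =
     {f. f \<in> borel_measurable lborel \<and> Lp_norm p f < \<top> \<and> besov_seminorm s p q f < \<top>}"

definition is_density :: "('a::euclidean_space \<Rightarrow> real) \<Rightarrow> bool" where
  "is_density f \<longleftrightarrow>
     f \<in> borel_measurable lborel \<and> (\<forall>x. 0 \<le> f x) \<and> (\<integral>\<^sup>+ x. ennreal (f x) \<partial>lborel) = 1"

definition marginal :: "(real ^ 'd \<Rightarrow> real) \<Rightarrow> 'd \<Rightarrow> real \<Rightarrow> real" where
  "marginal f l t =
     (LINT y|Pi\<^sub>M (UNIV - {l}) (\<lambda>_. lborel). f (\<chi> i. if i = l then t else y i))"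

definition product_of_marginals :: "(real ^ 'd \<Rightarrow> real) \<Rightarrow> bool" where
  "product_of_marginals f \<longleftrightarrow> (AE x in lborel. f x = (\<Prod>l\<in>UNIV. marginal f l (x $ l)))"

definition mixed_density :: "real ^ 'd ^ 'd \<Rightarrow> (real ^ 'd \<Rightarrow> real) \<Rightarrow> real ^ 'd \<Rightarrow> real" where
  "mixed_density A f x = \<bar>det (matrix_inv A)\<bar> * f (matrix_inv A *v x)"

text \<open>The joint law of an i.i.d. sample of size \<open>n\<close> with density \<open>g\<close>; a sample is a function whose
  values at \<open>0, \<dots>, n - 1\<close> are the observations.\<close>

definition sample_law :: "nat \<Rightarrow> (real ^ 'd \<Rightarrow> real) \<Rightarrow> (nat \<Rightarrow> real ^ 'd) measure" where
  "sample_law n g = Pi\<^sub>M {..<n} (\<lambda>_. density lborel (\<lambda>x. ennreal (g x)))"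

definition scaled :: "(real \<Rightarrow> real) \<Rightarrow> nat \<Rightarrow> int \<Rightarrow> real \<Rightarrow> real" where
  "scaled \<phi> j k x = 2 powr (real j / 2) * \<phi> (2 ^ j * x - of_int k)"

definition tensor_scaled :: "(real \<Rightarrow> real) \<Rightarrow> nat \<Rightarrow> int ^ 'd \<Rightarrow> real ^ 'd \<Rightarrow> real" where
  "tensor_scaled \<phi> j k x = (\<Prod>l\<in>UNIV. scaled \<phi> j (k $ l) (x $ l))"

definition coeff :: "(real \<Rightarrow> real) \<Rightarrow> (real ^ 'd \<Rightarrow> real) \<Rightarrow> nat \<Rightarrow> int ^ 'd \<Rightarrow> real" where
  "coeff \<phi> g j k = (LINT x|lborel. g x * tensor_scaled \<phi> j k x)"

definition marginal_coeff ::
    "(real \<Rightarrow> real) \<Rightarrow> (real ^ 'd \<Rightarrow> real) \<Rightarrow> nat \<Rightarrow> 'd \<Rightarrow> int \<Rightarrow> real" where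
  "marginal_coeff \<phi> g j l m = (LINT t|lborel. marginal g l t * scaled \<phi> j m t)"

text \<open>For compactly supported \<open>\<phi>\<close> and \<open>g\<close> only finitely many terms of the sums over \<open>k\<close> are nonzero.\<close>

definition wavelet_contrast :: "(real \<Rightarrow> real) \<Rightarrow> (real ^ 'd \<Rightarrow> real) \<Rightarrow> nat \<Rightarrow> real" where
  "wavelet_contrast \<phi> g j =
     (\<Sum>\<^sub>\<infinity>k\<in>UNIV. (coeff \<phi> g j k - (\<Prod>l\<in>UNIV. marginal_coeff \<phi> g j l (k $ l)))\<^sup>2)"

definition est_coeff ::
    "(real \<Rightarrow> real) \<Rightarrow> nat \<Rightarrow> nat \<Rightarrow> (nat \<Rightarrow> real ^ 'd) \<Rightarrow> int ^ 'd \<Rightarrow> real" where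
  "est_coeff \<phi> n j X k = 1 / real n * (\<Sum>i<n. tensor_scaled \<phi> j k (X i))"

definition est_marginal_coeff ::
    "(real \<Rightarrow> real) \<Rightarrow> nat \<Rightarrow> nat \<Rightarrow> (nat \<Rightarrow> real ^ 'd) \<Rightarrow> 'd \<Rightarrow> int \<Rightarrow> real" where
  "est_marginal_coeff \<phi> n j X l m = 1 / real n * (\<Sum>i<n. scaled \<phi> j m (X i $ l))"

definition contrast_estimator :: "(real \<Rightarrow> real) \<Rightarrow> nat \<Rightarrow> nat \<Rightarrow> (nat \<Rightarrow> real ^ 'd) \<Rightarrow> real" where
  "contrast_estimator \<phi> n j X =
     (\<Sum>\<^sub>\<infinity>k\<in>UNIV. (est_coeff \<phi> n j X k - (\<Prod>l\<in>UNIV. est_marginal_coeff \<phi> n j X l (k $ l)))\<^sup>2)"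

end

theory Submission
  imports Defs
begin

text \<open>
  Write \<open>e k = \<alpha> k - \<Prod>l. \<alpha> l (k l)\<close> for a coefficient of the contrast and \<open>\<delta> k\<close> for the error made in
  estimating it, so that the estimator exceeds the contrast by \<open>(\<Sum>k. (\<delta> k)\<^sup>2) + 2 * (\<Sum>k. e k * \<delta> k)\<close>.
  By compactness of the supports only finitely many \<open>k\<close> matter, and \<open>\<Sum>k. (e k)\<^sup>2\<close> is bounded uniformly in
  \<open>j\<close> by Bessel's inequality because the density is square integrable; everything thus rests on
  \<open>\<Sum>k. (\<delta> k)\<^sup>2\<close>, whose mean is \<open>O(N / n)\<close> and whose second moment is \<open>O((N / n)\<^sup>2)\<close>, where \<open>N = 2 ^ (j * d)\<close>.

  The error of the joint coefficients is the mean of i.i.d. centered vectors of squared length \<open>O(N)\<close>,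
  for which the second and fourth moments of the norm are bounded by adding one observation at a
  time. The error of the product of marginal coefficients is expanded over the set \<open>S\<close> of perturbed
  factors. Its sums of squares factorise over the coordinates, and since a perturbation of one
  coordinate has squared length at most \<open>O(2 ^ j)\<close> surely, all factors but one can be bounded
  trivially. For the bias the linear term matters: the contributions with \<open>card S = 1\<close> have mean zero,
  and those with \<open>card S \<ge> 2\<close> contain two small factors, hence are again \<open>O(N / n)\<close>.
\<close>

subsection \<open>Lebesgue measure on a cartesian power\<close>

lemma prod_Basis_vec: "(\<Prod>b\<in>(Basis :: (real ^ 'd) set). g b) = (\<Prod>i\<in>UNIV. g (axis i 1))"
proof -
  have B: "(Basis :: (real ^ 'd) set) = (\<lambda>i. axis i 1) ` UNIV"
    by (auto simp: Basis_vec_def)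
  have inj: "inj (\<lambda>i. axis i (1::real) :: real ^ 'd)"
    by (auto simp: inj_on_def axis_eq_axis)
  show ?thesis
    unfolding B by (subst prod.reindex[OF inj]) simp
qed

lemma measurable_vec_lambda [measurable]:
  fixes f :: "'a \<Rightarrow> 'd::finite \<Rightarrow> real"
  assumes "\<And>i. (\<lambda>x. f x i) \<in> borel_measurable M"
  shows "(\<lambda>x. \<chi> i. f x i) \<in> borel_measurable M"
  by (rule iffD2[OF borel_measurable_euclidean_space])
     (use assms in \<open>auto simp: Basis_vec_def inner_axis\<close>)

lemma measurable_vec_nth [measurable]:
  "(\<lambda>x :: real ^ 'd. x $ i) \<in> borel_measurable borel"
  by (rule borel_measurable_continuous_onI) (intro continuous_intros)

lemma measurable_matrix_vector_mult [measurable]: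
  "(*v) (A :: real ^ 'd ^ 'd) \<in> borel_measurable borel"
  by (rule borel_measurable_continuous_onI) (intro continuous_intros)

interpretation lebesgue_product: product_sigma_finite "\<lambda>_. lborel :: real measure"
  by (rule product_sigma_finite.intro) (rule sigma_finite_lborel)

text \<open>Lebesgue measure is determined by the volumes of boxes, and an open box pulls back to a
  product of intervals. Integrals over vectors thereby become Fubini integrals over a product of
  lines.\<close>

lemma lborel_vec_eq_distr_PiM:
  "(lborel :: (real ^ 'd) measure) = distr (Pi\<^sub>M UNIV (\<lambda>_. lborel)) borel (\<lambda>y. \<chi> i. y i)"
proof (rule lborel_eqI)
  fix l u :: "real ^ 'd"
  assume le: "\<And>b. b \<in> Basis \<Longrightarrow> l \<bullet> b \<le> u \<bullet> b"
  have le': "l $ i \<le> u $ i" for i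
    using le[of "axis i 1"] by (auto simp: Basis_vec_def inner_axis)
  have "(\<lambda>y. \<chi> i. y i) -` box l u \<inter> space (Pi\<^sub>M UNIV (\<lambda>_. lborel)) =
      Pi\<^sub>E UNIV (\<lambda>i. {l $ i <..< u $ i})"
    by (auto simp: mem_box_cart space_PiM PiE_iff)
  then have "emeasure (distr (Pi\<^sub>M UNIV (\<lambda>_. lborel)) borel (\<lambda>y. \<chi> i. y i)) (box l u) =
      (\<Prod>i\<in>UNIV. emeasure lborel {l $ i <..< u $ i})"
    by (subst emeasure_distr) (auto simp: lebesgue_product.emeasure_PiM)
  also have "\<dots> = (\<Prod>i\<in>UNIV. ennreal (u $ i - l $ i))"
    using le' by simp
  also have "\<dots> = (\<Prod>b\<in>Basis. (u - l) \<bullet> b)"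
    using le' by (simp add: prod_Basis_vec inner_axis prod_ennreal)
  finally show "emeasure (distr (Pi\<^sub>M UNIV (\<lambda>_. lborel)) borel (\<lambda>y. \<chi> i. y i)) (box l u) =
      (\<Prod>b\<in>Basis. (u - l) \<bullet> b)" .
qed simp

text \<open>Tonelli with the chosen coordinate innermost; it serves for shears, which move a single
  coordinate.\<close>

lemma nn_integral_lborel_vec_insert:
  fixes h :: "real ^ 'd \<Rightarrow> ennreal"
  assumes [measurable]: "h \<in> borel_measurable borel"
  shows "(\<integral>\<^sup>+x. h x \<partial>lborel) =
    (\<integral>\<^sup>+y. (\<integral>\<^sup>+t. h (\<chi> i. (y(l := t)) i) \<partial>lborel) \<partial>Pi\<^sub>M (UNIV - {l}) (\<lambda>_. lborel))"
proof -
  have "(\<integral>\<^sup>+x. h x \<partial>lborel) = (\<integral>\<^sup>+y. h (\<chi> i. y i) \<partial>Pi\<^sub>M (insert l (UNIV - {l})) (\<lambda>_. lborel))"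
    by (subst lborel_vec_eq_distr_PiM, subst nn_integral_distr) (auto simp: insert_absorb)
  also have "\<dots> = (\<integral>\<^sup>+y. (\<integral>\<^sup>+t. h (\<chi> i. (y(l := t)) i) \<partial>lborel) \<partial>Pi\<^sub>M (UNIV - {l}) (\<lambda>_. lborel))"
    by (rule lebesgue_product.product_nn_integral_insert) auto
  finally show ?thesis .
qed

text \<open>The change of variables of the library requires a well-ordered index type.\<close>

lemma nn_integral_linear_substitution:
  fixes A :: "real ^ 'd ^ 'd" and h :: "real ^ 'd \<Rightarrow> ennreal"
  assumes "det A \<noteq> 0" and "h \<in> borel_measurable borel"
  shows "(\<integral>\<^sup>+x. h x \<partial>lborel) = ennreal \<bar>det A\<bar> * (\<integral>\<^sup>+x. h (A *v x) \<partial>lborel)"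
proof -
  \<comment> \<open>Every matrix is a product of diagonal matrices, swaps, shears and matrices with
    a zero row. Quantifying over \<open>h\<close> inside the induction lets the second factor of a
    product be applied to \<open>\<lambda>x. h (A *v x)\<close>.\<close>
  have "\<forall>h \<in> borel_measurable borel. det A \<noteq> 0 \<longrightarrow>
    (\<integral>\<^sup>+x. h x \<partial>lborel) = ennreal \<bar>det A\<bar> * (\<integral>\<^sup>+x. h (A *v x) \<partial>lborel)"
  proof (induction A rule: induct_matrix_elementary)
    case (1 A B)
    show ?case
    proof (intro ballI impI)
      fix h :: "real ^ 'd \<Rightarrow> ennreal"
      assume [measurable]: "h \<in> borel_measurable borel" and d: "det (A ** B) \<noteq> 0"
      have d': "det A \<noteq> 0" "det B \<noteq> 0"
        using d by (auto simp: det_mul)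
      have "(\<integral>\<^sup>+x. h x \<partial>lborel) = ennreal \<bar>det A\<bar> * (\<integral>\<^sup>+x. h (A *v x) \<partial>lborel)"
        by (rule 1(1)[rule_format]) (use d' in simp_all)
      also have "(\<integral>\<^sup>+x. h (A *v x) \<partial>lborel) = ennreal \<bar>det B\<bar> * (\<integral>\<^sup>+x. h (A *v (B *v x)) \<partial>lborel)"
        by (rule 1(2)[rule_format]) (use d' in simp_all)
      finally show "(\<integral>\<^sup>+x. h x \<partial>lborel) =
          ennreal \<bar>det (A ** B)\<bar> * (\<integral>\<^sup>+x. h (A ** B *v x) \<partial>lborel)"
        by (simp add: det_mul abs_mult ennreal_mult mult_ac matrix_vector_mul_assoc)
    qed
  next
    case (2 A i)
    then have "det A = 0" by (simp add: det_zero_row)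
    then show ?case by simp
  next
    case (3 A)
    show ?case
    proof (intro ballI impI)
      fix h :: "real ^ 'd \<Rightarrow> ennreal"
      assume [measurable]: "h \<in> borel_measurable borel" and d: "det A \<noteq> 0"
      \<comment> \<open>The diagonal entries, indexed by basis vectors to match
        \<open>lborel_affine_euclidean\<close>.\<close>
      define c where "c = (\<lambda>b :: real ^ 'd. b \<bullet> (A *v b))"
      have c_axis: "c (axis i 1) = A $ i $ i" for i
        by (simp add: c_def inner_axis' matrix_vector_mul_component inner_axis)
      have det: "det A = (\<Prod>i\<in>UNIV. A $ i $ i)"
        by (rule det_diagonal) (use 3 in auto)
      have c0: "c b \<noteq> 0" if "b \<in> Basis" for b
        using that d by (auto simp: Basis_vec_def c_axis det)
      have T: "0 + (\<Sum>j\<in>Basis. (c j * (x \<bullet> j)) *\<^sub>R j) = A *v x" for x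
      proof -
        have "c j * (x \<bullet> j) = (A *v x) \<bullet> j" if j: "j \<in> Basis" for j
        proof -
          obtain i where i: "j = axis i 1"
            using j by (auto simp: Basis_vec_def)
          have "(A *v x) $ i = (\<Sum>k\<in>UNIV. if k = i then A $ i $ i * x $ i else 0)"
            unfolding matrix_vector_mult_def vec_lambda_beta
            by (rule sum.cong) (auto simp: 3)
          then show ?thesis
            by (simp add: i c_axis inner_axis)
        qed
        then show ?thesis
          by (simp add: euclidean_representation)
      qed
      have "lborel = density (distr lborel borel ((*v) A)) (\<lambda>_. ennreal (\<Prod>j\<in>Basis. \<bar>c j\<bar>))"
        using lborel_affine_euclidean[of c 0, OF c0] unfolding T by (simp add: prod_ennreal)
      also have "(\<Prod>j\<in>Basis. \<bar>c j\<bar>) = \<bar>det A\<bar>"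
        by (simp add: prod_Basis_vec c_axis det abs_prod)
      finally have eq: "lborel = density (distr lborel borel ((*v) A)) (\<lambda>_. ennreal \<bar>det A\<bar>)" .
      show "(\<integral>\<^sup>+x. h x \<partial>lborel) = ennreal \<bar>det A\<bar> * (\<integral>\<^sup>+x. h (A *v x) \<partial>lborel)"
        by (subst eq) (simp add: nn_integral_density nn_integral_distr nn_integral_cmult)
    qed
  next
    case (4 m n)
    define A :: "real ^ 'd ^ 'd" where "A = (\<chi> i j. mat 1 $ i $ Transposition.transpose m n j)"
    let ?p = "Transposition.transpose m n"
    have p: "?p permutes UNIV" by (rule permutes_swap_id) auto
    have det: "\<bar>det A\<bar> = 1"
      using det_permute_columns[OF p, of "mat 1 :: real ^ 'd ^ 'd"]
      by (simp add: A_def abs_mult sign_def)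
    have A: "(A *v x) $ i = x $ ?p i" for x i
    proof -
      have "(A *v x) $ i = (\<Sum>k\<in>UNIV. if k = ?p i then x $ ?p i else 0)"
        unfolding A_def matrix_vector_mult_def vec_lambda_beta
        by (rule sum.cong) (auto simp: mat_def)
      then show ?thesis by simp
    qed
    \<comment> \<open>The preimage of a box under a swap is the box with permuted sides, which has
      the same volume.\<close>
    have eq: "lborel = distr lborel borel ((*v) A)"
    proof (rule lborel_eqI)
      fix l u :: "real ^ 'd"
      assume le: "\<And>b. b \<in> Basis \<Longrightarrow> l \<bullet> b \<le> u \<bullet> b"
      have le': "l $ i \<le> u $ i" for i
        using le[of "axis i 1"] by (auto simp: Basis_vec_def inner_axis)
      have pre: "(*v) A -` box l u = box (\<chi> i. l $ ?p i) (\<chi> i. u $ ?p i)"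
        by (auto simp: mem_box_cart A) (metis transpose_involutory)+
      have "emeasure (distr lborel borel ((*v) A)) (box l u) =
          (\<Prod>b\<in>Basis. ((\<chi> i. u $ ?p i) - (\<chi> i. l $ ?p i)) \<bullet> b)"
        using le' by (subst emeasure_distr)
          (auto simp: pre emeasure_lborel_box_eq Basis_vec_def inner_axis)
      also have "\<dots> = (\<Prod>i\<in>UNIV. (u - l) $ ?p i)"
        by (simp add: prod_Basis_vec inner_axis)
      also have "\<dots> = (\<Prod>i\<in>UNIV. (u - l) $ i)"
        using prod.permute[OF p, of "\<lambda>i. (u - l) $ i"] by (simp add: o_def)
      finally show "emeasure (distr lborel borel ((*v) A)) (box l u) = (\<Prod>b\<in>Basis. (u - l) \<bullet> b)"
        by (simp add: prod_Basis_vec inner_axis)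
    qed simp
    show ?case
      unfolding A_def[symmetric] det
    proof (intro ballI impI)
      fix h :: "real ^ 'd \<Rightarrow> ennreal"
      assume [measurable]: "h \<in> borel_measurable borel"
      show "(\<integral>\<^sup>+x. h x \<partial>lborel) = ennreal 1 * (\<integral>\<^sup>+x. h (A *v x) \<partial>lborel)"
        by (subst eq) (simp add: nn_integral_distr)
    qed
  next
    case (5 m n c)
    define A :: "real ^ 'd ^ 'd" where "A = (\<chi> i j. if i = m \<and> j = n then c else of_bool (i = j))"
    have "A = (\<chi> k. if k = m then row m (mat 1) + c *s row n (mat 1) else row k (mat 1))"
      using 5 by (auto simp: A_def vec_eq_iff row_def mat_def)
    then have det: "det A = 1"
      using det_row_operation[OF 5, of "mat 1 :: real ^ 'd ^ 'd" c] by simp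
    have A: "A *v x = (\<chi> i. if i = m then x $ m + c * x $ n else x $ i)" for x
    proof (subst vec_eq_iff, intro allI)
      fix i
      have "(A *v x) $ i = (\<Sum>k\<in>UNIV. (if k = i then x $ i else 0) +
          (if k = n then (if i = m then c * x $ n else 0) else 0))"
        unfolding A_def matrix_vector_mult_def vec_lambda_beta
        by (rule sum.cong) (use 5 in auto)
      then show "(A *v x) $ i = (\<chi> i. if i = m then x $ m + c * x $ n else x $ i) $ i"
        by (simp add: sum.distrib)
    qed
    show ?case
      unfolding A_def[symmetric] det
    proof (intro ballI impI)
      fix h :: "real ^ 'd \<Rightarrow> ennreal"
      assume [measurable]: "h \<in> borel_measurable borel"
      \<comment> \<open>With the other coordinates fixed, the shear translates coordinate
        \<open>m\<close> by \<open>c * y n\<close>, a constant because \<open>n\<close> differs from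
        \<open>m\<close>; translation invariance on the line suffices.\<close>
      have shift: "(\<integral>\<^sup>+t. h (A *v (\<chi> i. (y(m := t)) i)) \<partial>lborel) =
          (\<integral>\<^sup>+t. h (\<chi> i. (y(m := t)) i) \<partial>lborel)" for y :: "'d \<Rightarrow> real"
      proof -
        have [measurable]: "(\<lambda>t. \<chi> i. (y(m := t)) i) \<in> borel_measurable borel"
          by (rule measurable_vec_lambda) (simp add: fun_upd_def)
        have [measurable]: "(\<lambda>t. h (\<chi> i. (y(m := t)) i)) \<in> borel_measurable borel"
          by measurable
        have "(\<integral>\<^sup>+t. h (\<chi> i. (y(m := t)) i) \<partial>lborel) =
          (\<integral>\<^sup>+t. h (\<chi> i. (y(m := c * y n + 1 * t)) i) \<partial>lborel)"
          by (subst nn_integral_real_affine[where c = 1 and t = "c * y n"]) simp_all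
        also have "(\<lambda>t. \<chi> i. (y(m := c * y n + 1 * t)) i) = (\<lambda>t. A *v (\<chi> i. (y(m := t)) i))"
          using 5 by (auto simp: A vec_eq_iff fun_eq_iff)
        finally show ?thesis by (simp add: fun_eq_iff)
      qed
      have "(\<integral>\<^sup>+x. h (A *v x) \<partial>lborel) = (\<integral>\<^sup>+x. h x \<partial>lborel)"
        using nn_integral_lborel_vec_insert[of "\<lambda>x. h (A *v x)" m]
          nn_integral_lborel_vec_insert[of h m] by (simp only: shift) measurable
      then show "(\<integral>\<^sup>+x. h x \<partial>lborel) = ennreal \<bar>1\<bar> * (\<integral>\<^sup>+x. h (A *v x) \<partial>lborel)"
        by simp
    qed
  qed
  then show ?thesis
    using assms by blast
qed

text \<open>The determinant in \<open>mixed_density\<close> is the Jacobian of the substitution by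
  \<open>matrix_inv A\<close>.\<close>

lemma is_density_mixed_density:
  fixes A :: "real ^ 'd ^ 'd"
  assumes "is_density f" "invertible A"
  shows "is_density (mixed_density A f)"
proof -
  have [measurable]: "f \<in> borel_measurable borel"
    using assms by (simp add: is_density_def)
  have "invertible (matrix_inv A)"
    using someI_ex[OF assms(2)[unfolded invertible_def]] by (auto simp: matrix_inv_def invertible_def)
  then have "det (matrix_inv A) \<noteq> 0"
    by (simp add: invertible_det_nz)
  then have "(\<integral>\<^sup>+x. ennreal (f x) \<partial>lborel) =
      ennreal \<bar>det (matrix_inv A)\<bar> * (\<integral>\<^sup>+x. ennreal (f (matrix_inv A *v x)) \<partial>lborel)"
    by (rule nn_integral_linear_substitution) simp
  also have "\<dots> = (\<integral>\<^sup>+x. ennreal (mixed_density A f x) \<partial>lborel)"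
    using assms by (simp add: mixed_density_def ennreal_mult is_density_def nn_integral_cmult)
  finally show ?thesis
    using assms by (auto simp: is_density_def mixed_density_def[abs_def])
qed

subsection \<open>Moments of sums of independent vectors\<close>

lemma square_sum_le_card:
  fixes a :: "'k \<Rightarrow> real"
  shows "(\<Sum>k\<in>F. a k)\<^sup>2 \<le> real (card F) * (\<Sum>k\<in>F. (a k)\<^sup>2)"
  using Cauchy_Schwarz_ineq_sum[of "\<lambda>_. 1" a F] by simp

lemma square_add_le: "(a + b)\<^sup>2 \<le> 2 * a\<^sup>2 + 2 * (b :: real)\<^sup>2"
  using sum_squares_bound[of a b] by (simp add: power2_sum)

lemma square_diff_le: "(a - b)\<^sup>2 \<le> 2 * a\<^sup>2 + 2 * (b :: real)\<^sup>2"
  using square_add_le[of a "-b"] by simp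

section \<open>Expectations under the law of an i.i.d. sample\<close>

locale iid = prob_space M for M :: "'a measure"
begin

abbreviation law :: "nat \<Rightarrow> (nat \<Rightarrow> 'a) measure" where
  "law n \<equiv> Pi\<^sub>M {..<n} (\<lambda>_. M)"

sublocale product: product_prob_space "\<lambda>_. M" UNIV
  by unfold_locales

lemma prob_space_law: "prob_space (law n)"
  by (rule prob_space_PiM) (rule prob_space_axioms)

lemma measurable_law_component:
  assumes "f \<in> borel_measurable M" "i < n"
  shows "(\<lambda>X. f (X i)) \<in> borel_measurable (law n)"
  using assms by (intro measurable_compose[OF measurable_component_singleton]) auto

lemma integrable_law_bounded:
  fixes f :: "_ \<Rightarrow> real"
  assumes "f \<in> borel_measurable (law n)" "\<And>X. \<bar>f X\<bar> \<le> B"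
  shows "integrable (law n) f"
proof -
  interpret L: prob_space "law n" by (rule prob_space_law)
  show ?thesis
    by (rule L.integrable_const_bound[of _ B]) (use assms in auto)
qed

lemma integrable_bounded:
  fixes f :: "_ \<Rightarrow> real"
  assumes "f \<in> borel_measurable M" "\<And>x. \<bar>f x\<bar> \<le> B"
  shows "integrable M f"
  by (rule integrable_const_bound[of _ B]) (use assms in auto)

lemma expectation_law_component:
  fixes f :: "'a \<Rightarrow> real"
  assumes "f \<in> borel_measurable M" "i < n"
  shows "(LINT X|law n. f (X i)) = (LINT x|M. f x)"
proof -
  have "distr (law n) M (\<lambda>X. X i) = M"
    using distr_PiM_component[of "{..<n}" "\<lambda>_. M" i] assms(2) prob_space_axioms by simp
  then have "(LINT x|M. f x) = (LINT x|distr (law n) M (\<lambda>X. X i). f x)"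
    by simp
  also have "\<dots> = (LINT X|law n. f (X i))"
    by (rule integral_distr) (use assms in auto)
  finally show ?thesis ..
qed

text \<open>Fubini with the last observation split off; this drives the inductions on the sample
  size.\<close>

lemma integral_law_Suc:
  fixes f :: "_ \<Rightarrow> real"
  assumes "integrable (law (Suc n)) f"
  shows "integral\<^sup>L (law (Suc n)) f = (LINT X|law n. LINT x|M. f (X(n := x)))"
  using product.product_integral_insert[of "{..<n}" n f] assms
  by (simp add: lessThan_Suc)

lemma square_expectation_le:
  fixes f :: "'a \<Rightarrow> real"
  assumes "f \<in> borel_measurable M" "\<And>x. \<bar>f x\<bar> \<le> B"
  shows "(LINT x|M. f x)\<^sup>2 \<le> (LINT x|M. (f x)\<^sup>2)"
proof -
  have "(f x)\<^sup>2 \<le> B\<^sup>2" for x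
    using power_mono[OF assms(2), of x 2] by simp
  then have "integrable M (\<lambda>x. (f x)\<^sup>2)"
    by (intro integrable_bounded[of _ "B\<^sup>2"]) (use assms in auto)
  moreover have "integrable M f"
    by (rule integrable_bounded[OF assms])
  ultimately have "(LINT x|M. (f x)\<^sup>2) - (LINT x|M. f x)\<^sup>2 = variance f"
    by (simp add: variance_eq)
  moreover have "0 \<le> variance f"
    by simp
  ultimately show ?thesis
    by linarith
qed

end

text \<open>The family is read as one random vector with index set \<open>F\<close>. Its squared
  length is bounded at every point, so quantities built from it are bounded and integrability comes
  for free.\<close>

locale bounded_energy = iid M for M :: "'a measure" +
  fixes F :: "'k set" and Z :: "'k \<Rightarrow> 'a \<Rightarrow> real" and c :: real
  assumes finite_F: "finite F"
    and Z_measurable [measurable]: "\<And>k. k \<in> F \<Longrightarrow> Z k \<in> borel_measurable M"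
    and Z_bound: "\<And>x. (\<Sum>k\<in>F. (Z k x)\<^sup>2) \<le> c"
begin

lemma c_nonneg: "0 \<le> c"
  using Z_bound[of undefined] by (meson order_trans sum_nonneg zero_le_power2)

lemma Z_abs_le: "k \<in> F \<Longrightarrow> \<bar>Z k x\<bar> \<le> sqrt c"
proof -
  assume "k \<in> F"
  then have "(Z k x)\<^sup>2 \<le> c"
    using Z_bound[of x] member_le_sum[of k F "\<lambda>k. (Z k x)\<^sup>2"] finite_F by auto
  then show ?thesis
    by (simp add: real_le_rsqrt)
qed

lemma integrable_Z: "k \<in> F \<Longrightarrow> integrable M (Z k)"
  by (rule integrable_bounded[of _ "sqrt c"]) (auto simp: Z_abs_le)

text \<open>Jensen's inequality in each coordinate, after which the second moments add up to the
  mean squared length.\<close>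

lemma sum_square_expectation_le: "(\<Sum>k\<in>F. (LINT x|M. Z k x)\<^sup>2) \<le> c"
proof -
  have Z2: "(Z k x)\<^sup>2 \<le> c" if "k \<in> F" for k x
    using power_mono[OF Z_abs_le[OF that, of x], of 2] c_nonneg by simp
  have "(\<Sum>k\<in>F. (LINT x|M. Z k x)\<^sup>2) \<le> (\<Sum>k\<in>F. (LINT x|M. (Z k x)\<^sup>2))"
    by (intro sum_mono square_expectation_le[of _ "sqrt c"]) (auto simp: Z_abs_le)
  also have "\<dots> = (LINT x|M. (\<Sum>k\<in>F. (Z k x)\<^sup>2))"
    by (intro Bochner_Integration.integral_sum[symmetric] integrable_bounded[of _ c]) (auto simp: Z2)
  also have "\<dots> \<le> (LINT x|M. c)"
    by (intro integral_mono' Z_bound) (auto simp: c_nonneg)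
  finally show ?thesis by (simp add: prob_space)
qed

end

section \<open>Second and fourth moments of the length of a sum of centered vectors\<close>

locale centered_iid = bounded_energy M F Y c
  for M :: "'a measure" and F :: "'k set" and Y c +
  assumes Y_centered: "\<And>k. k \<in> F \<Longrightarrow> (LINT x|M. Y k x) = 0"
begin

text \<open>The squared Euclidean length of the position of a random walk after \<open>n\<close>
  steps.\<close>

definition energy :: "nat \<Rightarrow> (nat \<Rightarrow> 'a) \<Rightarrow> real" where
  "energy n X = (\<Sum>k\<in>F. (\<Sum>i<n. Y k (X i))\<^sup>2)"

lemma energy_nonneg: "0 \<le> energy n X"
  by (simp add: energy_def sum_nonneg)

text \<open>The worst case, without cancellation between observations. Besides integrability it
  yields the sure bound on \<open>sq_deviation\<close>.\<close>

lemma energy_le: "energy n X \<le> (real n)\<^sup>2 * c"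
proof -
  have "energy n X \<le> (\<Sum>k\<in>F. real n * (\<Sum>i<n. (Y k (X i))\<^sup>2))"
    unfolding energy_def using square_sum_le_card[of _ "{..<n}"] by (intro sum_mono) simp
  also have "\<dots> = real n * (\<Sum>i<n. \<Sum>k\<in>F. (Y k (X i))\<^sup>2)"
    by (simp add: sum_distrib_left[symmetric] sum.swap[of _ F])
  also have "\<dots> \<le> real n * (\<Sum>i<n. c)"
    by (intro mult_left_mono sum_mono Z_bound) auto
  finally show ?thesis by (simp add: power2_eq_square)
qed

lemma energy_measurable [measurable]: "energy n \<in> borel_measurable (law n)"
  unfolding energy_def[abs_def] by measurable

lemma integrable_energy [simp, intro]: "integrable (law n) (energy n)"
  by (rule integrable_law_bounded[of _ _ "(real n)\<^sup>2 * c"])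
    (auto simp: abs_of_nonneg[OF energy_nonneg] energy_le)

lemma integrable_energy_square [simp, intro]: "integrable (law n) (\<lambda>X. (energy n X)\<^sup>2)"
  by (rule integrable_law_bounded[of _ _ "((real n)\<^sup>2 * c)\<^sup>2"])
    (auto intro!: power_mono simp: energy_nonneg energy_le)

lemma energy_Suc:
  "energy (Suc n) (X(n := x)) =
    energy n X + 2 * (\<Sum>k\<in>F. (\<Sum>i<n. Y k (X i)) * Y k x) + (\<Sum>k\<in>F. (Y k x)\<^sup>2)"
  by (simp add: energy_def power2_sum sum.distrib sum_distrib_left mult_ac)

lemma integral_cross_term: "(LINT x|M. (\<Sum>k\<in>F. t k * Y k x)) = 0"
  by (subst Bochner_Integration.integral_sum) (auto simp: Y_centered intro!: integrable_Z)

lemma integrable_cross_term: "integrable M (\<lambda>x. \<Sum>k\<in>F. t k * Y k x)"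
  by (auto intro!: integrable_Z)

text \<open>Given the past, the cross term has mean zero, so each new observation adds at most
  \<open>c\<close> to the mean.\<close>

lemma expectation_energy: "(LINT X|law n. energy n X) \<le> real n * c"
proof (induction n)
  case 0
  show ?case by (simp add: energy_def)
next
  case (Suc n)
  interpret L: prob_space "law n" by (rule prob_space_law)
  have inner: "(LINT x|M. energy (Suc n) (X(n := x))) \<le> energy n X + c" for X
  proof -
    let ?g = "\<lambda>x. energy n X + c + 2 * (\<Sum>k\<in>F. (\<Sum>i<n. Y k (X i)) * Y k x)"
    have le: "energy (Suc n) (X(n := x)) \<le> ?g x" for x
      using Z_bound[of x] by (simp add: energy_Suc)
    have "(LINT x|M. energy (Suc n) (X(n := x))) \<le> (LINT x|M. ?g x)"
      by (intro integral_mono' le order_trans[OF energy_nonneg le])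
        (auto intro!: integrable_cross_term)
    also have "\<dots> = energy n X + c"
      by (subst Bochner_Integration.integral_add)
        (auto simp: integral_cross_term prob_space intro!: integrable_cross_term)
    finally show ?thesis .
  qed
  have "(LINT X|law (Suc n). energy (Suc n) X) = (LINT X|law n. LINT x|M. energy (Suc n) (X(n := x)))"
    by (rule integral_law_Suc[OF integrable_energy])
  also have "\<dots> \<le> (LINT X|law n. energy n X + c)"
    by (intro integral_mono' inner) (auto intro!: add_nonneg_nonneg energy_nonneg c_nonneg)
  also have "\<dots> = (LINT X|law n. energy n X) + c"
    by (subst Bochner_Integration.integral_add) (auto simp: integrable_energy L.prob_space)
  finally show ?case
    using Suc by (simp add: algebra_simps)
qed

text \<open>In the induction step the cross term \<open>\<langle>T, y\<rangle>\<close> is integrated out exactly where it occurs linearly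
  and estimated by the Cauchy-Schwarz inequality otherwise.\<close>

lemma expectation_energy_square: "(LINT X|law n. (energy n X)\<^sup>2) \<le> 4 * (real n)\<^sup>2 * c\<^sup>2"
proof (induction n)
  case 0
  show ?case by (simp add: energy_def)
next
  case (Suc n)
  interpret L: prob_space "law n" by (rule prob_space_law)
  have inner: "(LINT x|M. (energy (Suc n) (X(n := x)))\<^sup>2) \<le>
      (energy n X)\<^sup>2 + 8 * c * energy n X + 3 * c\<^sup>2" for X
  proof -
    define A where "A = energy n X"
    define L where "L x = (\<Sum>k\<in>F. (\<Sum>i<n. Y k (X i)) * Y k x)" for x
    define Q where "Q x = (\<Sum>k\<in>F. (Y k x)\<^sup>2)" for x
    let ?g = "\<lambda>x. (A\<^sup>2 + 8 * c * A + 3 * c\<^sup>2) + 4 * A * L x"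
    have le: "(A + 2 * L x + Q x)\<^sup>2 \<le> ?g x" for x
    proof -
      have Q: "0 \<le> Q x" "Q x \<le> c"
        using Z_bound by (auto simp: Q_def sum_nonneg)
      have A: "0 \<le> A" by (simp add: A_def energy_nonneg)
      have "(L x)\<^sup>2 \<le> A * Q x"
        unfolding A_def L_def Q_def energy_def by (rule Cauchy_Schwarz_ineq_sum)
      also have "\<dots> \<le> A * c"
        using Q A by (intro mult_left_mono) auto
      finally have L2: "(L x)\<^sup>2 \<le> A * c" .
      have AQ: "A * Q x \<le> A * c"
        using Q A by (intro mult_left_mono) auto
      have Q2: "(Q x)\<^sup>2 \<le> c\<^sup>2"
        using Q by (intro power_mono) auto
      \<comment> \<open>Splitting this mixed term turns the coefficients of the squares of
        \<open>L x\<close> and \<open>Q x\<close> from 4 and 1 into 6 and 3. The 8 in the target is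
        then 6 from the square of \<open>L x\<close> plus 2 from \<open>A * Q x\<close>.\<close>
      have "4 * (L x * Q x) \<le> 2 * (L x)\<^sup>2 + 2 * (Q x)\<^sup>2"
        using sum_squares_bound[of "L x" "Q x"] by simp
      then have "(A + 2 * L x + Q x)\<^sup>2 \<le>
          A\<^sup>2 + 6 * (L x)\<^sup>2 + 3 * (Q x)\<^sup>2 + 2 * (A * Q x) + 4 * A * L x"
        by (simp add: power2_eq_square algebra_simps)
      then show ?thesis
        using L2 AQ Q2 by (simp add: algebra_simps)
    qed
    have int: "integrable M L"
      unfolding L_def by (rule integrable_cross_term)
    have "(LINT x|M. (energy (Suc n) (X(n := x)))\<^sup>2) \<le> (LINT x|M. ?g x)"
      unfolding energy_Suc A_def[symmetric] L_def[symmetric] Q_def[symmetric]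
      by (intro integral_mono' le order_trans[OF zero_le_power2 le]) (use int in auto)
    also have "\<dots> = (A\<^sup>2 + 8 * c * A + 3 * c\<^sup>2) + 4 * A * (LINT x|M. L x)"
      by (subst Bochner_Integration.integral_add) (use int in \<open>auto simp: prob_space\<close>)
    also have "(LINT x|M. L x) = 0"
      unfolding L_def by (rule integral_cross_term)
    finally show ?thesis by (simp add: A_def fun_upd_def)
  qed
  have "(LINT X|law (Suc n). (energy (Suc n) X)\<^sup>2) =
      (LINT X|law n. LINT x|M. (energy (Suc n) (X(n := x)))\<^sup>2)"
    by (rule integral_law_Suc[OF integrable_energy_square])
  also have "\<dots> \<le> (LINT X|law n. (energy n X)\<^sup>2 + 8 * c * energy n X + 3 * c\<^sup>2)"
    by (intro integral_mono' inner) (auto intro!: add_nonneg_nonneg mult_nonneg_nonneg energy_nonneg c_nonneg)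
  also have "\<dots> = (LINT X|law n. (energy n X)\<^sup>2) + 8 * c * (LINT X|law n. energy n X) + 3 * c\<^sup>2"
    by (simp add: L.prob_space)
  also have "\<dots> \<le> 4 * (real n)\<^sup>2 * c\<^sup>2 + 8 * c * (real n * c) + 3 * c\<^sup>2"
    using Suc expectation_energy[of n] c_nonneg by (intro add_mono mult_left_mono) auto
  \<comment> \<open>The constant 4 closes the recursion: \<open>4 * n\<^sup>2 + 8 * n + 3\<close> is
    at most \<open>4 * (n + 1)\<^sup>2\<close>.\<close>
  also have "\<dots> \<le> 4 * (real (Suc n))\<^sup>2 * c\<^sup>2"
    by (simp add: power2_eq_square algebra_simps)
  finally show ?case .
qed

end

section \<open>Empirical means and their deviation from the expectation\<close>

locale sampled_family = bounded_energy M F Z c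
  for M :: "'a measure" and F :: "'k set" and Z c
begin

text \<open>Centering costs a factor 4: the squared length of a difference is at most twice the sum
  of the squared lengths, and both the vector and its mean have squared length at most
  \<open>c\<close>.\<close>

sublocale centered: centered_iid M F "\<lambda>k x. Z k x - (LINT x|M. Z k x)" "4 * c"
proof
  fix x
  have "(\<Sum>k\<in>F. (Z k x - (LINT x|M. Z k x))\<^sup>2) \<le>
      (\<Sum>k\<in>F. 2 * (Z k x)\<^sup>2 + 2 * (LINT x|M. Z k x)\<^sup>2)"
    by (intro sum_mono square_diff_le)
  also have "\<dots> = 2 * (\<Sum>k\<in>F. (Z k x)\<^sup>2) + 2 * (\<Sum>k\<in>F. (LINT x|M. Z k x)\<^sup>2)"
    by (simp add: sum.distrib sum_distrib_left)
  also have "\<dots> \<le> 4 * c"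
    using Z_bound[of x] sum_square_expectation_le by simp
  finally show "(\<Sum>k\<in>F. (Z k x - (LINT x|M. Z k x))\<^sup>2) \<le> 4 * c" .
qed (auto simp: finite_F integrable_Z prob_space)

definition deviation :: "nat \<Rightarrow> (nat \<Rightarrow> 'a) \<Rightarrow> 'k \<Rightarrow> real" where
  "deviation n X k = 1 / real n * (\<Sum>i<n. Z k (X i)) - (LINT x|M. Z k x)"

definition sq_deviation :: "nat \<Rightarrow> (nat \<Rightarrow> 'a) \<Rightarrow> real" where
  "sq_deviation n X = (\<Sum>k\<in>F. (deviation n X k)\<^sup>2)"

lemma sq_deviation_nonneg: "0 \<le> sq_deviation n X"
  by (simp add: sq_deviation_def sum_nonneg)

text \<open>For \<open>n = 0\<close> division by zero would turn the empirical mean into 0 and the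
  deviation into minus the expectation, whence the assumption on \<open>n\<close>.\<close>

lemma sq_deviation_eq_energy:
  assumes "n \<ge> 1"
  shows "sq_deviation n X = centered.energy n X / (real n)\<^sup>2"
proof -
  have "deviation n X k = (\<Sum>i<n. Z k (X i) - (LINT x|M. Z k x)) / real n" for k
    using assms by (simp add: deviation_def sum_subtractf field_simps)
  then show ?thesis
    by (simp only: sq_deviation_def centered.energy_def power_divide sum_divide_distrib[symmetric])
qed

lemma measurable_deviation [measurable]:
  assumes "k \<in> F"
  shows "(\<lambda>X. deviation n X k) \<in> borel_measurable (law n)"
  using assms unfolding deviation_def by measurable

lemma measurable_sq_deviation [measurable]: "sq_deviation n \<in> borel_measurable (law n)"
  unfolding sq_deviation_def[abs_def] by measurable

lemma sq_deviation_le: "n \<ge> 1 \<Longrightarrow> sq_deviation n X \<le> 4 * c"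
  using centered.energy_le[of n X] by (simp add: sq_deviation_eq_energy field_simps)

lemma integrable_sq_deviation: "n \<ge> 1 \<Longrightarrow> integrable (law n) (sq_deviation n)"
  by (rule integrable_law_bounded[of _ _ "4 * c"])
    (auto simp: abs_of_nonneg[OF sq_deviation_nonneg] sq_deviation_le)

lemma integrable_sq_deviation_square: "n \<ge> 1 \<Longrightarrow> integrable (law n) (\<lambda>X. (sq_deviation n X)\<^sup>2)"
  by (rule integrable_law_bounded[of _ _ "(4 * c)\<^sup>2"])
    (auto simp only: abs_power2 intro!: power_mono sq_deviation_nonneg sq_deviation_le
      measurable_sq_deviation borel_measurable_power)

lemma expectation_sq_deviation:
  assumes "n \<ge> 1"
  shows "(LINT X|law n. sq_deviation n X) \<le> 4 * c / real n"
proof -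
  have "(LINT X|law n. sq_deviation n X) = (LINT X|law n. centered.energy n X) / (real n)\<^sup>2"
    by (simp add: sq_deviation_eq_energy[OF assms])
  also have "\<dots> \<le> real n * (4 * c) / (real n)\<^sup>2"
    by (intro divide_right_mono centered.expectation_energy) simp
  also have "\<dots> = 4 * c / real n"
    using assms by (simp add: power2_eq_square)
  finally show ?thesis .
qed

text \<open>The constant is \<open>4 * 4\<^sup>2\<close>: the first factor is that of the fourth
  moment, the second comes from the bound \<open>4 * c\<close> of the centered family.\<close>

lemma expectation_sq_deviation_square:
  assumes "n \<ge> 1"
  shows "(LINT X|law n. (sq_deviation n X)\<^sup>2) \<le> 64 * (c / real n)\<^sup>2"
proof -
  have "(LINT X|law n. (sq_deviation n X)\<^sup>2) =
      (LINT X|law n. (centered.energy n X)\<^sup>2) / ((real n)\<^sup>2)\<^sup>2"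
    by (simp add: sq_deviation_eq_energy[OF assms] power_divide)
  also have "\<dots> \<le> (4 * (real n)\<^sup>2 * (4 * c)\<^sup>2) / ((real n)\<^sup>2)\<^sup>2"
    by (intro divide_right_mono centered.expectation_energy_square) simp
  also have "\<dots> = 64 * (c / real n)\<^sup>2"
    using assms by (simp add: field_simps power2_eq_square)
  finally show ?thesis .
qed

lemma integrable_component: "k \<in> F \<Longrightarrow> i < n \<Longrightarrow> integrable (law n) (\<lambda>X. Z k (X i))"
  by (rule integrable_law_bounded[of _ _ "sqrt c"]) (auto simp: Z_abs_le)

lemma integrable_deviation: "k \<in> F \<Longrightarrow> integrable (law n) (\<lambda>X. deviation n X k)"
proof -
  assume k: "k \<in> F"
  interpret L: prob_space "law n" by (rule prob_space_law)
  show ?thesis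
    unfolding deviation_def using k
    by (intro Bochner_Integration.integrable_diff integrable_mult_right
        Bochner_Integration.integrable_sum integrable_component L.integrable_const) auto
qed

lemma expectation_deviation:
  assumes "k \<in> F" "n \<ge> 1"
  shows "(LINT X|law n. deviation n X k) = 0"
proof -
  interpret L: prob_space "law n" by (rule prob_space_law)
  have "(LINT X|law n. deviation n X k) =
      1 / real n * (\<Sum>i<n. (LINT X|law n. Z k (X i))) - (LINT x|M. Z k x)"
    unfolding deviation_def using assms
    by (subst Bochner_Integration.integral_diff)
      (auto simp: integrable_component Bochner_Integration.integral_sum L.prob_space
        intro!: integrable_divide Bochner_Integration.integrable_sum)
  also have "(\<Sum>i<n. (LINT X|law n. Z k (X i))) = real n * (LINT x|M. Z k x)"
    using assms by (simp add: expectation_law_component)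
  finally show ?thesis
    using assms by simp
qed

end

subsection \<open>Perturbation of a product\<close>

text \<open>Distributivity; it reduces sums over multi-indices to sums over one coordinate.\<close>

lemma sum_PiE_prod:
  fixes f :: "'d::finite \<Rightarrow> 'm \<Rightarrow> real"
  assumes "finite F"
  shows "(\<Sum>k\<in>PiE UNIV (\<lambda>_. F). \<Prod>l\<in>UNIV. f l (k l)) = (\<Prod>l\<in>UNIV. \<Sum>m\<in>F. f l m)"
  using assms by (subst prod_sum_PiE) auto

text \<open>A deterministic setting, used for each fixed sample: \<open>a\<close> stands for the
  exact marginal coefficients and \<open>w\<close> for their estimation errors. \<open>G\<close>
  will not depend on the level, whereas \<open>\<beta>\<close> is a sure bound that grows with it.
  Both are at least 1, so that powers increase with the exponent.\<close>

locale product_perturbation =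
  fixes F :: "'m set" and a w :: "'d::finite \<Rightarrow> 'm \<Rightarrow> real" and G \<beta> :: real
  assumes finite_F: "finite F"
    and G_ge: "1 \<le> G" and \<beta>_ge: "1 \<le> \<beta>"
    and a_bound: "\<And>l. (\<Sum>m\<in>F. (a l m)\<^sup>2) \<le> G"
    and w_bound: "\<And>l. (\<Sum>m\<in>F. (w l m)\<^sup>2) \<le> \<beta>"
begin

abbreviation K :: "('d \<Rightarrow> 'm) set" where "K \<equiv> PiE UNIV (\<lambda>_. F)"

definition W :: "'d \<Rightarrow> real" where "W l = (\<Sum>m\<in>F. (w l m)\<^sup>2)"

definition monomial :: "'d set \<Rightarrow> ('d \<Rightarrow> 'm) \<Rightarrow> real" where
  "monomial S k = (\<Prod>l\<in>S. w l (k l)) * (\<Prod>l\<in>UNIV - S. a l (k l))"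

text \<open>One perturbed coordinate is kept exact in \<open>W\<close>, and all other factors are
  replaced by their trivial bounds.\<close>

definition Q :: real where "Q = G ^ CARD('d) * \<beta> ^ (CARD('d) - 1) * (\<Sum>l\<in>UNIV. W l)"

lemma W_nonneg: "0 \<le> W l"
  by (simp add: W_def sum_nonneg)

lemma W_le: "W l \<le> \<beta>"
  by (simp add: W_def w_bound)

lemma Q_nonneg: "0 \<le> Q"
  using G_ge \<beta>_ge by (simp add: Q_def sum_nonneg W_nonneg)

lemma sum_monomial_square:
  "(\<Sum>k\<in>K. (monomial S k)\<^sup>2) = (\<Prod>l\<in>S. W l) * (\<Prod>l\<in>UNIV - S. \<Sum>m\<in>F. (a l m)\<^sup>2)"
proof -
  have split: "(\<Prod>l\<in>UNIV. if l \<in> S then f l else g l) = (\<Prod>l\<in>S. f l) * (\<Prod>l\<in>UNIV - S. g l)"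
    for f g :: "'d \<Rightarrow> real"
    by (subst prod.If_cases) (auto simp: Compl_eq_Diff_UNIV)
  have "(\<Sum>k\<in>K. (monomial S k)\<^sup>2) =
      (\<Sum>k\<in>K. \<Prod>l\<in>UNIV. (if l \<in> S then (w l (k l))\<^sup>2 else (a l (k l))\<^sup>2))"
    by (simp add: monomial_def split power_mult_distrib prod_power_distrib)
  also have "\<dots> = (\<Prod>l\<in>UNIV. \<Sum>m\<in>F. (if l \<in> S then (w l m)\<^sup>2 else (a l m)\<^sup>2))"
    by (rule sum_PiE_prod[OF finite_F])
  also have "\<dots> = (\<Prod>l\<in>UNIV. if l \<in> S then W l else (\<Sum>m\<in>F. (a l m)\<^sup>2))"
    by (intro prod.cong) (auto simp: W_def)
  finally show ?thesis by (simp add: split)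
qed

lemma prod_a_le: "(\<Prod>l\<in>UNIV - S. \<Sum>m\<in>F. (a l m)\<^sup>2) \<le> G ^ CARD('d)"
proof -
  have "(\<Prod>l\<in>UNIV - S. \<Sum>m\<in>F. (a l m)\<^sup>2) \<le> (\<Prod>l\<in>UNIV - S. G)"
    by (intro prod_mono) (auto simp: sum_nonneg a_bound)
  also have "\<dots> \<le> G ^ CARD('d)"
    using G_ge by (auto intro!: power_increasing card_mono)
  finally show ?thesis .
qed

lemma prod_W_le:
  assumes "card S \<le> r"
  shows "(\<Prod>l\<in>S. W l) \<le> \<beta> ^ r"
proof -
  have "(\<Prod>l\<in>S. W l) \<le> (\<Prod>l\<in>S. \<beta>)"
    by (intro prod_mono) (auto simp: W_nonneg W_le)
  also have "\<dots> \<le> \<beta> ^ r"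
    using \<beta>_ge assms by (auto intro!: power_increasing)
  finally show ?thesis .
qed

lemma prod_a_nonneg: "0 \<le> (\<Prod>l\<in>S. \<Sum>m\<in>F. (a l m)\<^sup>2)"
  by (intro prod_nonneg) (auto simp: sum_nonneg)

lemma W_le_sum: "W l \<le> (\<Sum>l\<in>UNIV. W l)"
  by (intro member_le_sum) (auto simp: W_nonneg)

text \<open>One perturbed coordinate is kept, and the others, at most \<open>CARD('d) - 1\<close> of
  them, are bounded by \<open>\<beta>\<close>.\<close>

lemma sum_monomial_square_le:
  assumes "S \<noteq> {}"
  shows "(\<Sum>k\<in>K. (monomial S k)\<^sup>2) \<le> Q"
proof -
  obtain l where l: "l \<in> S" using assms by auto
  have "card (S - {l}) \<le> CARD('d) - 1"
    using l by (simp add: card_Diff_singleton card_mono diff_le_mono)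
  then have "W l * (\<Prod>l\<in>S - {l}. W l) \<le> (\<Sum>l\<in>UNIV. W l) * \<beta> ^ (CARD('d) - 1)"
    by (intro mult_mono W_le_sum prod_W_le) (auto intro!: sum_nonneg prod_nonneg W_nonneg)
  then have "(\<Prod>l\<in>S. W l) \<le> (\<Sum>l\<in>UNIV. W l) * \<beta> ^ (CARD('d) - 1)"
    using l by (simp add: prod.remove[of S l])
  then have "(\<Sum>k\<in>K. (monomial S k)\<^sup>2) \<le> ((\<Sum>l\<in>UNIV. W l) * \<beta> ^ (CARD('d) - 1)) * G ^ CARD('d)"
    unfolding sum_monomial_square using \<beta>_ge
    by (intro mult_mono prod_a_le prod_a_nonneg) (auto intro!: sum_nonneg mult_nonneg_nonneg W_nonneg)
  then show ?thesis by (simp add: Q_def mult_ac)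
qed

text \<open>Two perturbed coordinates are kept, which produces the square of the sum of
  \<open>W\<close>; the exponents of \<open>\<beta>\<close> and \<open>G\<close> are then enlarged
  to fit the square of \<open>Q\<close>.\<close>

lemma sum_monomial_square_le_square:
  assumes "2 \<le> card S"
  shows "(\<Sum>k\<in>K. (monomial S k)\<^sup>2) \<le> Q\<^sup>2"
proof -
  obtain l where l: "l \<in> S" using assms by (cases "S = {}") auto
  have "card (S - {l}) = card S - 1" using l by simp
  then have "S - {l} \<noteq> {}" using assms by (metis Suc_1 card.empty diff_is_0_eq not_less_eq_eq One_nat_def)
  then obtain l' where l': "l' \<in> S" "l' \<noteq> l" by auto
  have "card (S - {l} - {l'}) \<le> card (UNIV - {l} :: 'd set)"
    by (intro card_mono) auto
  then have "card (S - {l} - {l'}) \<le> CARD('d) - 1" by simp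
  then have "W l * (W l' * (\<Prod>l\<in>S - {l} - {l'}. W l)) \<le>
      (\<Sum>l\<in>UNIV. W l) * ((\<Sum>l\<in>UNIV. W l) * \<beta> ^ (CARD('d) - 1))"
    by (intro mult_mono W_le_sum prod_W_le)
      (use \<beta>_ge in \<open>auto intro!: sum_nonneg prod_nonneg mult_nonneg_nonneg W_nonneg\<close>)
  also have "W l * (W l' * (\<Prod>l\<in>S - {l} - {l'}. W l)) = (\<Prod>l\<in>S. W l)"
    using l l' by (simp add: prod.remove[of S l] prod.remove[of "S - {l}" l'])
  finally have "(\<Prod>l\<in>S. W l) \<le> (\<Sum>l\<in>UNIV. W l) * ((\<Sum>l\<in>UNIV. W l) * \<beta> ^ (CARD('d) - 1))" .
  then have "(\<Sum>k\<in>K. (monomial S k)\<^sup>2) \<le>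
      ((\<Sum>l\<in>UNIV. W l) * ((\<Sum>l\<in>UNIV. W l) * \<beta> ^ (CARD('d) - 1))) * G ^ CARD('d)"
    unfolding sum_monomial_square using \<beta>_ge
    by (intro mult_mono prod_a_le prod_a_nonneg) (auto intro!: sum_nonneg mult_nonneg_nonneg W_nonneg)
  also have "\<dots> = (\<Sum>l\<in>UNIV. W l)\<^sup>2 * (\<beta> ^ (CARD('d) - 1) * G ^ CARD('d))"
    by (simp add: power2_eq_square)
  also have "\<dots> \<le> (\<Sum>l\<in>UNIV. W l)\<^sup>2 * (\<beta> ^ (CARD('d) - 1) * G ^ CARD('d))\<^sup>2"
  proof (intro mult_left_mono)
    have "1 \<le> \<beta> ^ (CARD('d) - 1) * G ^ CARD('d)"
      using mult_mono[of 1 "\<beta> ^ (CARD('d) - 1)" 1 "G ^ CARD('d)"] \<beta>_ge G_ge by simp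
    then show "\<beta> ^ (CARD('d) - 1) * G ^ CARD('d) \<le> (\<beta> ^ (CARD('d) - 1) * G ^ CARD('d))\<^sup>2"
      by (simp add: power2_eq_square mult_le_cancel_left1)
  qed simp
  finally show ?thesis by (simp add: Q_def power_mult_distrib mult_ac)
qed

lemma prod_perturbed:
  "(\<Prod>l\<in>UNIV. a l (k l) + w l (k l)) = (\<Prod>l\<in>UNIV. a l (k l)) + (\<Sum>S\<in>UNIV - {{}}. monomial S k)"
proof -
  have "(\<Prod>l\<in>UNIV. w l (k l) + a l (k l)) = (\<Sum>S\<in>UNIV. monomial S k)"
    by (subst prod_add) (auto simp: monomial_def)
  also have "\<dots> = monomial {} k + (\<Sum>S\<in>UNIV - {{}}. monomial S k)"
    by (rule sum.remove) auto
  finally show ?thesis by (simp add: monomial_def add.commute)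
qed

lemma card_subsets_le: "card (A :: 'd set set) \<le> 2 ^ CARD('d)"
proof -
  have "card A \<le> card (UNIV :: 'd set set)" by (intro card_mono) auto
  then show ?thesis by (simp add: card_UNIV_set)
qed

text \<open>There are at most \<open>2 ^ CARD('d)\<close> nonempty sets of perturbed coordinates.
  Their number enters twice: through Cauchy-Schwarz and through the summation of the bounds.\<close>

lemma sum_perturbation_square_le:
  "(\<Sum>k\<in>K. ((\<Prod>l\<in>UNIV. a l (k l) + w l (k l)) - (\<Prod>l\<in>UNIV. a l (k l)))\<^sup>2) \<le> 4 ^ CARD('d) * Q"
proof -
  let ?A = "UNIV - {{}} :: 'd set set"
  have c: "real (card ?A) \<le> 2 ^ CARD('d)"
    using card_subsets_le[of ?A] by (metis of_nat_le_iff of_nat_numeral of_nat_power)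
  have "(\<Sum>k\<in>K. ((\<Prod>l\<in>UNIV. a l (k l) + w l (k l)) - (\<Prod>l\<in>UNIV. a l (k l)))\<^sup>2) =
      (\<Sum>k\<in>K. (\<Sum>S\<in>?A. monomial S k)\<^sup>2)"
    by (simp add: prod_perturbed)
  also have "\<dots> \<le> (\<Sum>k\<in>K. real (card ?A) * (\<Sum>S\<in>?A. (monomial S k)\<^sup>2))"
    by (intro sum_mono square_sum_le_card)
  also have "\<dots> = real (card ?A) * (\<Sum>S\<in>?A. \<Sum>k\<in>K. (monomial S k)\<^sup>2)"
    by (simp add: sum_distrib_left[symmetric] sum.swap[of _ K])
  also have "\<dots> \<le> real (card ?A) * (\<Sum>S\<in>?A. Q)"
    by (intro mult_left_mono sum_mono sum_monomial_square_le) auto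
  also have "\<dots> = (real (card ?A))\<^sup>2 * Q"
    by (simp add: power2_eq_square)
  also have "\<dots> \<le> (2 ^ CARD('d))\<^sup>2 * Q"
    using c by (intro mult_right_mono power_mono Q_nonneg) auto
  also have "(2 ^ CARD('d))\<^sup>2 = (4 ^ CARD('d) :: real)"
    by (simp add: power2_eq_square flip: power_mult_distrib)
  finally show ?thesis .
qed

text \<open>Once the singletons are subtracted, every remaining set has at least two perturbed
  coordinates, and Cauchy-Schwarz against \<open>e\<close> leaves a term of order \<open>Q\<close>
  instead of its square root.\<close>

lemma second_order_remainder_le:
  assumes e: "(\<Sum>k\<in>K. (e k)\<^sup>2) \<le> E" "1 \<le> E"
  shows "\<bar>(\<Sum>k\<in>K. e k * ((\<Prod>l\<in>UNIV. a l (k l) + w l (k l)) - (\<Prod>l\<in>UNIV. a l (k l)))) -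
      (\<Sum>l\<in>UNIV. \<Sum>k\<in>K. e k * monomial {l} k)\<bar> \<le> 2 ^ CARD('d) * (E * Q)"
proof -
  let ?A = "UNIV - {{}} :: 'd set set"
  let ?B = "range (\<lambda>l :: 'd. {l})"
  have c: "real (card (?A - ?B)) \<le> 2 ^ CARD('d)"
    using card_subsets_le[of "?A - ?B"] by (metis of_nat_le_iff of_nat_numeral of_nat_power)
  have le: "\<bar>\<Sum>k\<in>K. e k * monomial S k\<bar> \<le> E * Q" if S: "S \<in> ?A - ?B" for S
  proof -
    have "card S \<noteq> 0" "card S \<noteq> 1"
      using S by (auto simp: card_1_singleton_iff)
    then have "2 \<le> card S" by linarith
    then have "(\<Sum>k\<in>K. (e k)\<^sup>2) * (\<Sum>k\<in>K. (monomial S k)\<^sup>2) \<le> E * Q\<^sup>2"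
      using e by (intro mult_mono sum_monomial_square_le_square) (auto simp: sum_nonneg)
    then have "(\<Sum>k\<in>K. e k * monomial S k)\<^sup>2 \<le> E * Q\<^sup>2"
      using Cauchy_Schwarz_ineq_sum order_trans by blast
    \<comment> \<open>Because \<open>E\<close> is at least 1, it may be replaced by its square,
      which avoids a square root.\<close>
    also have "\<dots> \<le> (E * Q)\<^sup>2"
      unfolding power_mult_distrib
      using e(2) by (intro mult_right_mono) (auto simp: power2_eq_square)
    finally show ?thesis
      using abs_le_square_iff[of "\<Sum>k\<in>K. e k * monomial S k" "E * Q"] e(2) Q_nonneg by simp
  qed
  have "(\<Sum>k\<in>K. e k * ((\<Prod>l\<in>UNIV. a l (k l) + w l (k l)) - (\<Prod>l\<in>UNIV. a l (k l)))) =
      (\<Sum>S\<in>?A. \<Sum>k\<in>K. e k * monomial S k)"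
    by (simp add: prod_perturbed sum_distrib_left sum.swap[of _ K])
  also have "\<dots> = (\<Sum>S\<in>?A - ?B. \<Sum>k\<in>K. e k * monomial S k) + (\<Sum>S\<in>?B. \<Sum>k\<in>K. e k * monomial S k)"
    by (rule sum.subset_diff) auto
  also have "(\<Sum>S\<in>?B. \<Sum>k\<in>K. e k * monomial S k) = (\<Sum>l\<in>UNIV. \<Sum>k\<in>K. e k * monomial {l} k)"
    by (subst sum.reindex) (auto simp: inj_on_def)
  finally have "\<bar>(\<Sum>k\<in>K. e k * ((\<Prod>l\<in>UNIV. a l (k l) + w l (k l)) - (\<Prod>l\<in>UNIV. a l (k l)))) -
      (\<Sum>l\<in>UNIV. \<Sum>k\<in>K. e k * monomial {l} k)\<bar> = \<bar>\<Sum>S\<in>?A - ?B. \<Sum>k\<in>K. e k * monomial S k\<bar>"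
    by simp
  also have "\<dots> \<le> (\<Sum>S\<in>?A - ?B. \<bar>\<Sum>k\<in>K. e k * monomial S k\<bar>)"
    by (rule sum_abs)
  also have "\<dots> \<le> (\<Sum>S\<in>?A - ?B. E * Q)"
    by (intro sum_mono le)
  also have "\<dots> = real (card (?A - ?B)) * (E * Q)"
    by simp
  also have "\<dots> \<le> 2 ^ CARD('d) * (E * Q)"
    using c e(2) Q_nonneg by (intro mult_right_mono) auto
  finally show ?thesis .
qed

end

subsection \<open>Bias and quadratic risk\<close>

text \<open>The contrast restricted to a finite box of indices, with \<open>\<psi> l m\<close> in
  the role of the scaled function of coordinate \<open>l\<close>. The bound \<open>b\<close> on
  pointwise squared length is allowed to be large; the bound \<open>G\<close> on the energy of the
  exact coefficients is kept separate because it stays fixed.\<close>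

locale contrast_model = iid M for M :: "'a measure" +
  fixes \<psi> :: "'d::finite \<Rightarrow> 'm \<Rightarrow> 'a \<Rightarrow> real" and F :: "'m set" and b G :: real
  assumes finite_F: "finite F"
    and \<psi>_measurable [measurable]: "\<And>l m. m \<in> F \<Longrightarrow> \<psi> l m \<in> borel_measurable M"
    and \<psi>_bound: "\<And>l x. (\<Sum>m\<in>F. (\<psi> l m x)\<^sup>2) \<le> b"
    and b_ge: "1 \<le> b" and G_ge: "1 \<le> G"
    and marginal_energy: "\<And>l. (\<Sum>m\<in>F. (LINT x|M. \<psi> l m x)\<^sup>2) \<le> G"
    and joint_energy: "(\<Sum>k\<in>PiE UNIV (\<lambda>_. F). (LINT x|M. (\<Prod>l\<in>UNIV. \<psi> l (k l) x))\<^sup>2) \<le> G"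
begin

abbreviation K :: "('d \<Rightarrow> 'm) set" where "K \<equiv> PiE UNIV (\<lambda>_. F)"

abbreviation \<Psi> :: "('d \<Rightarrow> 'm) \<Rightarrow> 'a \<Rightarrow> real" where "\<Psi> k x \<equiv> \<Prod>l\<in>UNIV. \<psi> l (k l) x"

lemma finite_K: "finite K"
  using finite_F by (intro finite_PiE) auto

sublocale coord: sampled_family M F "\<psi> l" b for l
  by unfold_locales (auto simp: finite_F \<psi>_bound)

text \<open>The squared length of the tensor vector is the product of the squared lengths over the
  coordinates; hence the power of \<open>b\<close>, which is the source of the factor
  \<open>2 ^ (j * d)\<close> in the rate.\<close>

sublocale joint: sampled_family M K \<Psi> "b ^ CARD('d)"
proof
  fix x
  have "(\<Sum>k\<in>K. (\<Psi> k x)\<^sup>2) = (\<Sum>k\<in>K. \<Prod>l\<in>UNIV. (\<psi> l (k l) x)\<^sup>2)"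
    by (simp add: prod_power_distrib)
  also have "\<dots> = (\<Prod>l\<in>UNIV. \<Sum>m\<in>F. (\<psi> l m x)\<^sup>2)"
    by (rule sum_PiE_prod[OF finite_F])
  also have "\<dots> \<le> (\<Prod>l\<in>(UNIV :: 'd set). b)"
    by (intro prod_mono) (auto simp: \<psi>_bound sum_nonneg)
  finally show "(\<Sum>k\<in>K. (\<Psi> k x)\<^sup>2) \<le> b ^ CARD('d)" by simp
qed (auto simp: finite_K PiE_iff intro!: borel_measurable_prod)

definition defect :: "('d \<Rightarrow> 'm) \<Rightarrow> real" where
  "defect k = (LINT x|M. \<Psi> k x) - (\<Prod>l\<in>UNIV. LINT x|M. \<psi> l (k l) x)"

definition contrast :: real where "contrast = (\<Sum>k\<in>K. (defect k)\<^sup>2)"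

definition estimator :: "nat \<Rightarrow> (nat \<Rightarrow> 'a) \<Rightarrow> real" where
  "estimator n X = (\<Sum>k\<in>K. (1 / real n * (\<Sum>i<n. \<Psi> k (X i)) -
     (\<Prod>l\<in>UNIV. 1 / real n * (\<Sum>i<n. \<psi> l (k l) (X i))))\<^sup>2)"

definition product_deviation :: "nat \<Rightarrow> (nat \<Rightarrow> 'a) \<Rightarrow> ('d \<Rightarrow> 'm) \<Rightarrow> real" where
  "product_deviation n X k = (\<Prod>l\<in>UNIV. (LINT x|M. \<psi> l (k l) x) + coord.deviation l n X (k l)) -
     (\<Prod>l\<in>UNIV. LINT x|M. \<psi> l (k l) x)"

text \<open>The sum of the squares of the \<open>\<delta> k\<close>.\<close>

definition error :: "nat \<Rightarrow> (nat \<Rightarrow> 'a) \<Rightarrow> real" where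
  "error n X = (\<Sum>k\<in>K. (joint.deviation n X k - product_deviation n X k)\<^sup>2)"

text \<open>The number \<open>Q\<close> of \<open>product_perturbation\<close> for the sample
  \<open>X\<close>, as a function that can be integrated.\<close>

definition perturbation_bound :: "nat \<Rightarrow> (nat \<Rightarrow> 'a) \<Rightarrow> real" where
  "perturbation_bound n X = G ^ CARD('d) * (4 * b) ^ (CARD('d) - 1) * (\<Sum>l\<in>UNIV. coord.sq_deviation l n X)"

text \<open>The part of the sum of the \<open>e k * \<delta> k\<close> that is of first order in the
  deviations: the joint error and the monomials with a single perturbed coordinate.\<close>

definition linear_part :: "nat \<Rightarrow> (nat \<Rightarrow> 'a) \<Rightarrow> real" where
  "linear_part n X = (\<Sum>k\<in>K. defect k * joint.deviation n X k) -
     (\<Sum>l\<in>UNIV. \<Sum>k\<in>K. defect k * (coord.deviation l n X (k l) *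
        (\<Prod>l'\<in>UNIV - {l}. LINT x|M. \<psi> l' (k l') x)))"

section \<open>Pointwise bounds for a fixed sample\<close>

lemma perturbation:
  assumes "n \<ge> 1"
  shows "product_perturbation F (\<lambda>l m. LINT x|M. \<psi> l m x) (\<lambda>l. coord.deviation l n X) G (4 * b)"
  using b_ge G_ge coord.sq_deviation_le[OF assms] unfolding coord.sq_deviation_def
  by unfold_locales (auto simp: finite_F marginal_energy)

text \<open>The joint coefficients have energy at most \<open>G\<close>, and that of the products of
  marginal coefficients factorises into at most \<open>G ^ CARD('d)\<close>. The bound is free of
  \<open>b\<close>.\<close>

lemma contrast_le: "contrast \<le> 4 * G ^ CARD('d)"
proof -
  have "contrast \<le> (\<Sum>k\<in>K. 2 * (LINT x|M. \<Psi> k x)\<^sup>2 + 2 * (\<Prod>l\<in>UNIV. LINT x|M. \<psi> l (k l) x)\<^sup>2)"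
    unfolding contrast_def defect_def by (intro sum_mono square_diff_le)
  also have "\<dots> = 2 * (\<Sum>k\<in>K. (LINT x|M. \<Psi> k x)\<^sup>2) +
      2 * (\<Sum>k\<in>K. \<Prod>l\<in>UNIV. (LINT x|M. \<psi> l (k l) x)\<^sup>2)"
    by (simp add: sum.distrib sum_distrib_left prod_power_distrib)
  also have "(\<Sum>k\<in>K. \<Prod>l\<in>UNIV. (LINT x|M. \<psi> l (k l) x)\<^sup>2) =
      (\<Prod>l\<in>UNIV. \<Sum>m\<in>F. (LINT x|M. \<psi> l m x)\<^sup>2)"
    by (rule sum_PiE_prod[OF finite_F])
  also have "\<dots> \<le> (\<Prod>l\<in>(UNIV :: 'd set). G)"
    by (intro prod_mono) (auto simp: marginal_energy sum_nonneg)
  finally have "contrast \<le> 2 * (\<Sum>k\<in>K. (LINT x|M. \<Psi> k x)\<^sup>2) + 2 * G ^ CARD('d)"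
    by simp
  moreover have "G \<le> G ^ CARD('d)"
    using power_increasing[of 1 "CARD('d)" G] G_ge by simp
  ultimately show ?thesis
    using joint_energy by linarith
qed

lemma contrast_nonneg: "0 \<le> contrast"
  by (simp add: contrast_def sum_nonneg)

lemma estimator_expansion:
  "estimator n X - contrast = error n X + 2 * (\<Sum>k\<in>K. defect k * (joint.deviation n X k - product_deviation n X k))"
proof -
  have "estimator n X = (\<Sum>k\<in>K. (defect k + (joint.deviation n X k - product_deviation n X k))\<^sup>2)"
    by (simp add: estimator_def defect_def product_deviation_def joint.deviation_def coord.deviation_def)
  also have "\<dots> = contrast + error n X + 2 * (\<Sum>k\<in>K. defect k * (joint.deviation n X k - product_deviation n X k))"
    by (simp add: power2_sum contrast_def error_def sum.distrib sum_distrib_left mult_ac)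
  finally show ?thesis by simp
qed

lemma error_nonneg: "0 \<le> error n X"
  by (simp add: error_def sum_nonneg)

lemma perturbation_bound_nonneg: "0 \<le> perturbation_bound n X"
  using b_ge G_ge by (simp add: perturbation_bound_def sum_nonneg coord.sq_deviation_nonneg)

lemma error_le:
  assumes "n \<ge> 1"
  shows "error n X \<le> 2 * joint.sq_deviation n X + 2 * 4 ^ CARD('d) * perturbation_bound n X"
proof -
  interpret P: product_perturbation F "\<lambda>l m. LINT x|M. \<psi> l m x" "\<lambda>l. coord.deviation l n X" G "4 * b"
    by (rule perturbation[OF assms])
  have "(\<Sum>k\<in>K. (product_deviation n X k)\<^sup>2) \<le> 4 ^ CARD('d) * perturbation_bound n X"
    using P.sum_perturbation_square_le
    by (simp add: product_deviation_def perturbation_bound_def P.Q_def P.W_def coord.sq_deviation_def)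
  moreover have "error n X \<le> (\<Sum>k\<in>K. 2 * (joint.deviation n X k)\<^sup>2 + 2 * (product_deviation n X k)\<^sup>2)"
    unfolding error_def by (intro sum_mono square_diff_le)
  ultimately show ?thesis
    by (simp add: joint.sq_deviation_def sum.distrib sum_distrib_left[symmetric])
qed

text \<open>The coefficient \<open>8 * 2 ^ CARD('d) * G ^ CARD('d)\<close> collects the factor 2 of
  the cross term, the \<open>2 ^ CARD('d)\<close> of the second-order remainder and the bound
  \<open>4 * G ^ CARD('d)\<close> on the contrast.\<close>

lemma estimator_linearization:
  assumes "n \<ge> 1"
  shows "\<bar>estimator n X - contrast - 2 * linear_part n X\<bar> \<le>
    2 * joint.sq_deviation n X + (2 * 4 ^ CARD('d) + 8 * 2 ^ CARD('d) * G ^ CARD('d)) * perturbation_bound n X"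
proof -
  interpret P: product_perturbation F "\<lambda>l m. LINT x|M. \<psi> l m x" "\<lambda>l. coord.deviation l n X" G "4 * b"
    by (rule perturbation[OF assms])
  have g: "1 \<le> G ^ CARD('d)" using G_ge by simp
  have aux: "\<bar>z\<bar> \<le> y + 2 * \<bar>t\<bar>" if "z = y - 2 * t" "0 \<le> y" for z y t :: real
    using that by linarith
  let ?R = "(\<Sum>k\<in>K. defect k * product_deviation n X k) - (\<Sum>l\<in>UNIV. \<Sum>k\<in>K. defect k * P.monomial {l} k)"
  have Q: "P.Q = perturbation_bound n X"
    by (simp add: perturbation_bound_def P.Q_def P.W_def coord.sq_deviation_def)
  have "\<bar>?R\<bar> \<le> 2 ^ CARD('d) * (4 * G ^ CARD('d) * P.Q)"
    unfolding product_deviation_def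
    by (rule P.second_order_remainder_le) (use contrast_le g in \<open>auto simp: contrast_def\<close>)
  then have R: "\<bar>?R\<bar> \<le> 2 ^ CARD('d) * (4 * G ^ CARD('d) * perturbation_bound n X)"
    unfolding Q .
  have "(\<Sum>k\<in>K. defect k * (joint.deviation n X k - product_deviation n X k)) = linear_part n X - ?R"
    by (simp add: linear_part_def P.monomial_def right_diff_distrib sum_subtractf)
  then have "estimator n X - contrast - 2 * linear_part n X = error n X - 2 * ?R"
    using estimator_expansion[of n X] by simp
  then have "\<bar>estimator n X - contrast - 2 * linear_part n X\<bar> \<le> error n X + 2 * \<bar>?R\<bar>"
    using aux error_nonneg by blast
  then show ?thesis
    using R error_le[OF assms, of X] by (simp add: algebra_simps)
qed

lemma measurable_estimator [measurable]: "estimator n \<in> borel_measurable (law n)"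
proof -
  have [measurable]: "(\<lambda>X. \<psi> l (k l) (X i)) \<in> borel_measurable (law n)"
    if "k \<in> K" "i < n" for k l i
    using that by (intro measurable_law_component) (auto simp: PiE_iff)
  show ?thesis
    unfolding estimator_def[abs_def] by measurable
qed

lemma measurable_error [measurable]: "error n \<in> borel_measurable (law n)"
proof -
  have [measurable]: "(\<lambda>X. coord.deviation l n X (k l)) \<in> borel_measurable (law n)" if "k \<in> K" for k l
    using that by (intro coord.measurable_deviation) (auto simp: PiE_iff)
  show ?thesis
    unfolding error_def[abs_def] product_deviation_def by measurable
qed

text \<open>Cauchy-Schwarz on the cross term, with the contrast bounded by
  \<open>contrast_le\<close>; 32 is \<open>2 * 2\<^sup>2 * 4\<close>.\<close>

lemma estimator_square_error_le:
  "(estimator n X - contrast)\<^sup>2 \<le> 2 * (error n X)\<^sup>2 + 32 * G ^ CARD('d) * error n X"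
proof -
  let ?L = "\<Sum>k\<in>K. defect k * (joint.deviation n X k - product_deviation n X k)"
  have "?L\<^sup>2 \<le> contrast * error n X"
    unfolding contrast_def error_def by (rule Cauchy_Schwarz_ineq_sum)
  also have "\<dots> \<le> (4 * G ^ CARD('d)) * error n X"
    by (intro mult_right_mono contrast_le error_nonneg)
  finally have "?L\<^sup>2 \<le> (4 * G ^ CARD('d)) * error n X" .
  moreover have "(estimator n X - contrast)\<^sup>2 \<le> 2 * (error n X)\<^sup>2 + 2 * (2 * ?L)\<^sup>2"
    unfolding estimator_expansion by (rule square_add_le)
  ultimately show ?thesis
    by (simp add: power_mult_distrib)
qed

lemma perturbation_bound_square_le:
  "(perturbation_bound n X)\<^sup>2 \<le> (G ^ CARD('d) * (4 * b) ^ (CARD('d) - 1))\<^sup>2 *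
     (real CARD('d) * (\<Sum>l\<in>UNIV. (coord.sq_deviation l n X)\<^sup>2))"
  unfolding perturbation_bound_def power_mult_distrib[of _ "sum _ _"] by (intro mult_left_mono square_sum_le_card) simp

section \<open>Expectations of the pointwise bounds, and the resulting bias and risk\<close>

lemma integrable_perturbation_bound: "n \<ge> 1 \<Longrightarrow> integrable (law n) (perturbation_bound n)"
  unfolding perturbation_bound_def[abs_def] by (auto intro!: coord.integrable_sq_deviation)

text \<open>The mean of \<open>sq_deviation\<close> brings a factor \<open>4 * b / n\<close>; its
  numerator completes the \<open>CARD('d) - 1\<close> trivially bounded factors to a full
  power.\<close>

lemma power_4b: "(4 * b) ^ (CARD('d) - 1) * (4 * b) = (4 * b) ^ CARD('d)"
  by (rule power_minus_mult) simp

lemma expectation_perturbation_bound: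
  assumes "n \<ge> 1"
  shows "(LINT X|law n. perturbation_bound n X) \<le> real CARD('d) * G ^ CARD('d) * 4 ^ CARD('d) * (b ^ CARD('d) / real n)"
proof -
  have "(LINT X|law n. perturbation_bound n X) = G ^ CARD('d) * (4 * b) ^ (CARD('d) - 1) *
      (\<Sum>l\<in>UNIV. (LINT X|law n. coord.sq_deviation l n X))"
    unfolding perturbation_bound_def using assms
    by (simp add: Bochner_Integration.integral_sum coord.integrable_sq_deviation)
  also have "\<dots> \<le> G ^ CARD('d) * (4 * b) ^ (CARD('d) - 1) * (\<Sum>l\<in>(UNIV :: 'd set). 4 * b / real n)"
    using b_ge G_ge
    by (intro mult_left_mono sum_mono coord.expectation_sq_deviation[OF assms]) auto
  also have "\<dots> = real CARD('d) * G ^ CARD('d) * ((4 * b) ^ (CARD('d) - 1) * (4 * b)) / real n"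
    by simp
  also have "\<dots> = real CARD('d) * G ^ CARD('d) * 4 ^ CARD('d) * (b ^ CARD('d) / real n)"
    unfolding power_4b by (simp add: power_mult_distrib)
  finally show ?thesis .
qed

lemma integrable_perturbation_bound_square: "n \<ge> 1 \<Longrightarrow> integrable (law n) (\<lambda>X. (perturbation_bound n X)\<^sup>2)"
proof -
  assume n: "n \<ge> 1"
  let ?B = "G ^ CARD('d) * (4 * b) ^ (CARD('d) - 1) * (\<Sum>l\<in>(UNIV :: 'd set). 4 * b)"
  have "perturbation_bound n X \<le> ?B" for X
    unfolding perturbation_bound_def using b_ge G_ge
    by (intro mult_left_mono sum_mono coord.sq_deviation_le[OF n]) auto
  then have "\<bar>(perturbation_bound n X)\<^sup>2\<bar> \<le> ?B\<^sup>2" for X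
    unfolding abs_power2 by (intro power_mono perturbation_bound_nonneg)
  then show ?thesis
    using integrable_perturbation_bound[OF n] by (intro integrable_law_bounded[of _ _ "?B\<^sup>2"]) auto
qed

lemma expectation_perturbation_bound_square:
  assumes "n \<ge> 1"
  shows "(LINT X|law n. (perturbation_bound n X)\<^sup>2) \<le>
    4 * (real CARD('d) * G ^ CARD('d) * 4 ^ CARD('d))\<^sup>2 * (b ^ CARD('d) / real n)\<^sup>2"
proof -
  let ?c = "(G ^ CARD('d) * (4 * b) ^ (CARD('d) - 1))\<^sup>2"
  have "(LINT X|law n. (perturbation_bound n X)\<^sup>2) \<le>
      (LINT X|law n. ?c * (real CARD('d) * (\<Sum>l\<in>UNIV. (coord.sq_deviation l n X)\<^sup>2)))"
    using assms
    by (intro integral_mono perturbation_bound_square_le integrable_perturbation_bound_square integrable_mult_right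
        Bochner_Integration.integrable_sum coord.integrable_sq_deviation_square) auto
  also have "\<dots> = ?c * (real CARD('d) * (\<Sum>l\<in>UNIV. (LINT X|law n. (coord.sq_deviation l n X)\<^sup>2)))"
    using assms
    by (simp add: Bochner_Integration.integral_sum coord.integrable_sq_deviation_square)
  also have "\<dots> \<le> ?c * (real CARD('d) * (\<Sum>l\<in>(UNIV :: 'd set). 64 * (b / real n)\<^sup>2))"
    by (intro mult_left_mono sum_mono coord.expectation_sq_deviation_square[OF assms]) auto
  \<comment> \<open>Since \<open>64 * b\<^sup>2\<close> is \<open>4 * (4 * b)\<^sup>2\<close>, a
    factor \<open>4 * b\<close> can join each of the two powers; the dimension is squared by the
    Cauchy-Schwarz factor and the sum over coordinates.\<close>
  also have "\<dots> = 4 * (real CARD('d) * G ^ CARD('d) * ((4 * b) ^ (CARD('d) - 1) * (4 * b)))\<^sup>2 / (real n)\<^sup>2"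
    by (simp add: power_mult_distrib power_divide power2_eq_square)
  also have "\<dots> = 4 * (real CARD('d) * G ^ CARD('d) * 4 ^ CARD('d))\<^sup>2 * (b ^ CARD('d) / real n)\<^sup>2"
    unfolding power_4b by (simp add: power_mult_distrib power_divide)
  finally show ?thesis .
qed

lemma integrable_linear_part: "integrable (law n) (linear_part n)"
  unfolding linear_part_def[abs_def]
  by (intro Bochner_Integration.integrable_diff Bochner_Integration.integrable_sum
      integrable_mult_right integrable_mult_left joint.integrable_deviation coord.integrable_deviation)
    (auto simp: PiE_iff)

lemma expectation_linear_part:
  assumes "n \<ge> 1"
  shows "(LINT X|law n. linear_part n X) = 0"
proof -
  have *: "k l \<in> F" if "k \<in> K" for k l using that by (auto simp: PiE_iff)
  have J: "(LINT X|law n. (\<Sum>k\<in>K. defect k * joint.deviation n X k)) = 0"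
    using assms
    by (subst Bochner_Integration.integral_sum)
      (auto simp: joint.expectation_deviation intro!: joint.integrable_deviation)
  have C: "(LINT X|law n. (\<Sum>l\<in>UNIV. \<Sum>k\<in>K. defect k * (coord.deviation l n X (k l) *
        (\<Prod>l'\<in>UNIV - {l}. LINT x|M. \<psi> l' (k l') x)))) = 0"
    using assms
    by (simp add: Bochner_Integration.integral_sum coord.integrable_deviation
        coord.expectation_deviation *)
  have iJ: "integrable (law n) (\<lambda>X. \<Sum>k\<in>K. defect k * joint.deviation n X k)"
    by (auto intro!: joint.integrable_deviation)
  have iC: "integrable (law n) (\<lambda>X. \<Sum>l\<in>UNIV. \<Sum>k\<in>K. defect k * (coord.deviation l n X (k l) *
        (\<Prod>l'\<in>UNIV - {l}. LINT x|M. \<psi> l' (k l') x)))"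
    by (intro Bochner_Integration.integrable_sum integrable_mult_right integrable_mult_left
        coord.integrable_deviation *)
  show ?thesis
    unfolding linear_part_def by (simp add: Bochner_Integration.integral_diff[OF iJ iC] J C)
qed

lemma error_bounded: "n \<ge> 1 \<Longrightarrow> \<exists>B. \<forall>X. \<bar>error n X\<bar> \<le> B"
proof (intro exI allI)
  fix X
  assume n: "n \<ge> 1"
  have "perturbation_bound n X \<le> G ^ CARD('d) * (4 * b) ^ (CARD('d) - 1) * (\<Sum>l\<in>(UNIV :: 'd set). 4 * b)"
    unfolding perturbation_bound_def using b_ge G_ge
    by (intro mult_left_mono sum_mono coord.sq_deviation_le[OF n]) auto
  then have "2 * 4 ^ CARD('d) * perturbation_bound n X \<le>
      2 * 4 ^ CARD('d) * (G ^ CARD('d) * (4 * b) ^ (CARD('d) - 1) * (\<Sum>l\<in>(UNIV :: 'd set). 4 * b))"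
    by (intro mult_left_mono) auto
  moreover have "2 * joint.sq_deviation n X \<le> 2 * (4 * b ^ CARD('d))"
    using joint.sq_deviation_le[OF n, of X] by (rule mult_left_mono) simp
  ultimately show "\<bar>error n X\<bar> \<le> 2 * (4 * b ^ CARD('d)) +
      2 * 4 ^ CARD('d) * (G ^ CARD('d) * (4 * b) ^ (CARD('d) - 1) * (\<Sum>l\<in>(UNIV :: 'd set). 4 * b))"
    unfolding abs_of_nonneg[OF error_nonneg]
    by (intro order_trans[OF error_le[OF n]] add_mono)
qed

lemma integrable_error:
  assumes "n \<ge> 1"
  shows "integrable (law n) (error n)" and "integrable (law n) (\<lambda>X. (error n X)\<^sup>2)"
proof -
  obtain B where B: "\<bar>error n X\<bar> \<le> B" for X
    using error_bounded[OF assms] by blast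
  show "integrable (law n) (error n)"
    by (rule integrable_law_bounded[OF _ B]) simp
  have "\<bar>(error n X)\<^sup>2\<bar> \<le> B\<^sup>2" for X
    using power_mono[OF B, of X 2] by simp
  then show "integrable (law n) (\<lambda>X. (error n X)\<^sup>2)"
    by (intro integrable_law_bounded[of _ _ "B\<^sup>2"]) auto
qed

text \<open>\<open>estimator_square_error_le\<close> dominates the squared error by an integrable
  function, and on a probability space the rest follows from that.\<close>

lemma integrable_estimator:
  assumes "n \<ge> 1"
  shows "integrable (law n) (estimator n)" and "integrable (law n) (\<lambda>X. (estimator n X)\<^sup>2)"
    and "integrable (law n) (\<lambda>X. (estimator n X - contrast)\<^sup>2)"
proof -
  interpret L: prob_space "law n" by (rule prob_space_law)
  have r: "(estimator n X - contrast)\<^sup>2 \<le> 2 * (error n X)\<^sup>2 + 32 * G ^ CARD('d) * error n X" for X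
    by (rule estimator_square_error_le)
  show sq: "integrable (law n) (\<lambda>X. (estimator n X - contrast)\<^sup>2)"
    by (rule Bochner_Integration.integrable_bound[of _ "\<lambda>X. 2 * (error n X)\<^sup>2 + 32 * G ^ CARD('d) * error n X"])
      (use integrable_error[OF assms] r error_nonneg G_ge in \<open>auto intro!: AE_I2\<close>)
  have diff: "integrable (law n) (\<lambda>X. estimator n X - contrast)"
    by (rule L.square_integrable_imp_integrable[OF _ sq]) simp
  have "integrable (law n) (\<lambda>X. (estimator n X - contrast) + contrast)"
    by (rule Bochner_Integration.integrable_add[OF diff]) simp
  then show "integrable (law n) (estimator n)" by simp
  have "integrable (law n) (\<lambda>X. (estimator n X - contrast)\<^sup>2 +
      2 * contrast * (estimator n X - contrast) + contrast\<^sup>2)"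
    using sq diff by (intro Bochner_Integration.integrable_add integrable_mult_right L.integrable_const)
  also have "(\<lambda>X. (estimator n X - contrast)\<^sup>2 + 2 * contrast * (estimator n X - contrast) + contrast\<^sup>2) =
      (\<lambda>X. (estimator n X)\<^sup>2)"
    by (auto simp: fun_eq_iff power2_eq_square algebra_simps)
  finally show "integrable (law n) (\<lambda>X. (estimator n X)\<^sup>2)" .
qed

text \<open>The linear part has mean zero and can be subtracted before absolute values are taken;
  what is left is of order \<open>b ^ CARD('d) / n\<close> in mean.\<close>

lemma bias_le:
  assumes "n \<ge> 1"
  shows "\<bar>(LINT X|law n. estimator n X) - contrast\<bar> \<le>
    (8 + (2 * 4 ^ CARD('d) + 8 * 2 ^ CARD('d) * G ^ CARD('d)) *
      (real CARD('d) * G ^ CARD('d) * 4 ^ CARD('d))) * (b ^ CARD('d) / real n)"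
proof -
  interpret L: prob_space "law n" by (rule prob_space_law)
  let ?g = "2 * 4 ^ CARD('d) + 8 * 2 ^ CARD('d) * G ^ CARD('d)"
  let ?r = "b ^ CARD('d) / real n"
  note int = integrable_estimator(1)[OF assms] integrable_linear_part[of n]
    joint.integrable_sq_deviation[OF assms] integrable_perturbation_bound[OF assms]
  have "(LINT X|law n. estimator n X) - contrast =
      (LINT X|law n. estimator n X - contrast - 2 * linear_part n X)"
    using int by (simp add: L.prob_space expectation_linear_part[OF assms])
  also have "\<bar>\<dots>\<bar> \<le> (LINT X|law n. \<bar>estimator n X - contrast - 2 * linear_part n X\<bar>)"
    by (rule integral_abs_bound)
  also have "\<dots> \<le> (LINT X|law n. 2 * joint.sq_deviation n X + ?g * perturbation_bound n X)"
    using int by (intro integral_mono estimator_linearization[OF assms]) auto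
  also have "\<dots> = 2 * (LINT X|law n. joint.sq_deviation n X) + ?g * (LINT X|law n. perturbation_bound n X)"
    using int by simp
  also have "\<dots> \<le> 2 * (4 * b ^ CARD('d) / real n) +
      ?g * (real CARD('d) * G ^ CARD('d) * 4 ^ CARD('d) * ?r)"
    using G_ge by (intro add_mono mult_left_mono joint.expectation_sq_deviation[OF assms]
        expectation_perturbation_bound[OF assms]) auto
  finally show ?thesis
    by (simp add: algebra_simps)
qed

lemma expectation_error:
  assumes "n \<ge> 1"
  shows "(LINT X|law n. error n X) \<le>
    (8 + 2 * 4 ^ CARD('d) * (real CARD('d) * G ^ CARD('d) * 4 ^ CARD('d))) * (b ^ CARD('d) / real n)"
proof -
  note int = joint.integrable_sq_deviation[OF assms] integrable_perturbation_bound[OF assms] integrable_error[OF assms]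
  have "(LINT X|law n. error n X) \<le>
      (LINT X|law n. 2 * joint.sq_deviation n X + 2 * 4 ^ CARD('d) * perturbation_bound n X)"
    using int by (intro integral_mono error_le[OF assms]) auto
  also have "\<dots> = 2 * (LINT X|law n. joint.sq_deviation n X) + 2 * 4 ^ CARD('d) * (LINT X|law n. perturbation_bound n X)"
    using int by simp
  also have "\<dots> \<le> 2 * (4 * b ^ CARD('d) / real n) +
      2 * 4 ^ CARD('d) * (real CARD('d) * G ^ CARD('d) * 4 ^ CARD('d) * (b ^ CARD('d) / real n))"
    by (intro add_mono mult_left_mono joint.expectation_sq_deviation[OF assms]
        expectation_perturbation_bound[OF assms]) auto
  finally show ?thesis
    by (simp add: algebra_simps)
qed

lemma expectation_error_square:
  assumes "n \<ge> 1"
  shows "(LINT X|law n. (error n X)\<^sup>2) \<le>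
    (512 + 32 * 16 ^ CARD('d) * (real CARD('d) * G ^ CARD('d) * 4 ^ CARD('d))\<^sup>2) *
      (b ^ CARD('d) / real n)\<^sup>2"
proof -
  note int = joint.integrable_sq_deviation_square[OF assms] integrable_perturbation_bound_square[OF assms]
    integrable_error[OF assms]
  have le: "(error n X)\<^sup>2 \<le> 8 * (joint.sq_deviation n X)\<^sup>2 + 8 * 16 ^ CARD('d) * (perturbation_bound n X)\<^sup>2" for X
  proof -
    have "(error n X)\<^sup>2 \<le> (2 * joint.sq_deviation n X + 2 * 4 ^ CARD('d) * perturbation_bound n X)\<^sup>2"
      by (intro power_mono error_le[OF assms] error_nonneg)
    also have "\<dots> \<le> 2 * (2 * joint.sq_deviation n X)\<^sup>2 + 2 * (2 * 4 ^ CARD('d) * perturbation_bound n X)\<^sup>2"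
      by (rule square_add_le)
    also have "(2 * 4 ^ CARD('d) * perturbation_bound n X)\<^sup>2 = 4 * (4 ^ CARD('d) * 4 ^ CARD('d)) * (perturbation_bound n X)\<^sup>2"
      by (simp add: power2_eq_square)
    also have "(4 ^ CARD('d) * 4 ^ CARD('d) :: real) = 16 ^ CARD('d)"
      by (simp flip: power_mult_distrib)
    finally show ?thesis by (simp add: power_mult_distrib)
  qed
  have "(LINT X|law n. (error n X)\<^sup>2) \<le>
      (LINT X|law n. 8 * (joint.sq_deviation n X)\<^sup>2 + 8 * 16 ^ CARD('d) * (perturbation_bound n X)\<^sup>2)"
    using int by (intro integral_mono le) auto
  also have "\<dots> = 8 * (LINT X|law n. (joint.sq_deviation n X)\<^sup>2) +
      8 * 16 ^ CARD('d) * (LINT X|law n. (perturbation_bound n X)\<^sup>2)"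
    using int by simp
  also have "\<dots> \<le> 8 * (64 * (b ^ CARD('d) / real n)\<^sup>2) + 8 * 16 ^ CARD('d) *
      (4 * (real CARD('d) * G ^ CARD('d) * 4 ^ CARD('d))\<^sup>2 * (b ^ CARD('d) / real n)\<^sup>2)"
    by (intro add_mono mult_left_mono joint.expectation_sq_deviation_square[OF assms]
        expectation_perturbation_bound_square[OF assms]) auto
  finally show ?thesis
    by (simp add: algebra_simps)
qed

lemma risk_le:
  assumes "n \<ge> 1"
  shows "(LINT X|law n. (estimator n X - contrast)\<^sup>2) \<le>
    2 * (LINT X|law n. (error n X)\<^sup>2) + 32 * G ^ CARD('d) * (LINT X|law n. error n X)"
proof -
  note int = integrable_error[OF assms] integrable_estimator[OF assms]
  have "(LINT X|law n. (estimator n X - contrast)\<^sup>2) \<le>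
      (LINT X|law n. 2 * (error n X)\<^sup>2 + 32 * G ^ CARD('d) * error n X)"
    using int by (intro integral_mono estimator_square_error_le) auto
  then show ?thesis
    using int by simp
qed

end

subsection \<open>Wavelet coefficients of a square-integrable density\<close>

text \<open>The integral of the square of \<open>c * f\<close> minus the sum of the
  \<open>\<beta> k * \<theta> k\<close> is nonnegative. The common squared norm \<open>c\<close> is
  arbitrary because the family used for the marginals is not normalised; scaling \<open>f\<close> by
  \<open>c\<close> avoids dividing.\<close>

lemma bessel_inequality:
  fixes f :: "'a \<Rightarrow> real" and \<theta> :: "'k \<Rightarrow> 'a \<Rightarrow> real"
  assumes "finite I" "0 < c"
    and f: "integrable M (\<lambda>x. (f x)\<^sup>2)"
    and f\<theta>: "\<And>k. k \<in> I \<Longrightarrow> integrable M (\<lambda>x. f x * \<theta> k x)"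
    and \<theta>\<theta>: "\<And>k k'. k \<in> I \<Longrightarrow> k' \<in> I \<Longrightarrow> integrable M (\<lambda>x. \<theta> k x * \<theta> k' x)"
    and orth: "\<And>k k'. k \<in> I \<Longrightarrow> k' \<in> I \<Longrightarrow>
      (LINT x|M. \<theta> k x * \<theta> k' x) = (if k = k' then c else 0)"
  shows "(\<Sum>k\<in>I. (LINT x|M. f x * \<theta> k x)\<^sup>2) \<le> c * (LINT x|M. (f x)\<^sup>2)"
proof -
  define \<beta> where "\<beta> k = (LINT x|M. f x * \<theta> k x)" for k
  have expand: "(c * f x - (\<Sum>k\<in>I. \<beta> k * \<theta> k x))\<^sup>2 = c\<^sup>2 * (f x)\<^sup>2 -
      2 * c * (\<Sum>k\<in>I. \<beta> k * (f x * \<theta> k x)) +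
      (\<Sum>k\<in>I. \<Sum>k'\<in>I. \<beta> k * \<beta> k' * (\<theta> k x * \<theta> k' x))" for x
    by (simp add: power2_diff power_mult_distrib sum_distrib_left power2_eq_square[of "sum _ _"]
        sum_product mult_ac)
  have i1: "integrable M (\<lambda>x. \<Sum>k\<in>I. \<beta> k * (f x * \<theta> k x))"
    using f\<theta> by auto
  have i2: "integrable M (\<lambda>x. \<Sum>k\<in>I. \<Sum>k'\<in>I. \<beta> k * \<beta> k' * (\<theta> k x * \<theta> k' x))"
    using \<theta>\<theta> by auto
  have e1: "(LINT x|M. (\<Sum>k\<in>I. \<beta> k * (f x * \<theta> k x))) = (\<Sum>k\<in>I. (\<beta> k)\<^sup>2)"
    using f\<theta> by (simp add: Bochner_Integration.integral_sum power2_eq_square flip: \<beta>_def)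
  have e2: "(LINT x|M. (\<Sum>k\<in>I. \<Sum>k'\<in>I. \<beta> k * \<beta> k' * (\<theta> k x * \<theta> k' x))) = c * (\<Sum>k\<in>I. (\<beta> k)\<^sup>2)"
  proof -
    have "(LINT x|M. (\<Sum>k\<in>I. \<Sum>k'\<in>I. \<beta> k * \<beta> k' * (\<theta> k x * \<theta> k' x))) =
        (\<Sum>k\<in>I. \<Sum>k'\<in>I. \<beta> k * \<beta> k' * (if k = k' then c else 0))"
      using \<theta>\<theta> by (simp add: Bochner_Integration.integral_sum orth)
    also have "\<dots> = (\<Sum>k\<in>I. c * (\<beta> k)\<^sup>2)"
      using assms(1) by (intro sum.cong) (auto simp: if_distrib power2_eq_square cong: if_cong)
    finally show ?thesis by (simp add: sum_distrib_left)
  qed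
  have "0 \<le> (LINT x|M. (c * f x - (\<Sum>k\<in>I. \<beta> k * \<theta> k x))\<^sup>2)"
    by (rule integral_nonneg_AE) simp
  also have "\<dots> = c\<^sup>2 * (LINT x|M. (f x)\<^sup>2) - 2 * c * (\<Sum>k\<in>I. (\<beta> k)\<^sup>2) + c * (\<Sum>k\<in>I. (\<beta> k)\<^sup>2)"
    unfolding expand using f i1 i2 by (simp add: e1 e2)
  finally have "c * (\<Sum>k\<in>I. (\<beta> k)\<^sup>2) \<le> c * (c * (LINT x|M. (f x)\<^sup>2))"
    by (simp add: power2_eq_square mult_ac)
  then show ?thesis
    using assms(2) by (simp add: \<beta>_def)
qed

section \<open>Integration over coordinates and marginals\<close>

lemma integral_lborel_vec_prod:
  fixes \<eta> :: "'d::finite \<Rightarrow> real \<Rightarrow> real"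
  assumes "\<And>l. integrable lborel (\<eta> l)"
  shows "integrable lborel (\<lambda>x :: real ^ 'd. \<Prod>l\<in>UNIV. \<eta> l (x $ l))"
    and "(LINT x|(lborel :: (real ^ 'd) measure). (\<Prod>l\<in>UNIV. \<eta> l (x $ l))) =
      (\<Prod>l\<in>UNIV. LINT t|lborel. \<eta> l t)"
proof -
  have [measurable]: "\<eta> l \<in> borel_measurable borel" for l
    using assms[of l] by auto
  show "integrable lborel (\<lambda>x :: real ^ 'd. \<Prod>l\<in>UNIV. \<eta> l (x $ l))"
    by (subst lborel_vec_eq_distr_PiM, subst integrable_distr_eq)
      (use lebesgue_product.product_integrable_prod[of UNIV \<eta>] assms in auto)
  show "(LINT x|(lborel :: (real ^ 'd) measure). (\<Prod>l\<in>UNIV. \<eta> l (x $ l))) =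
      (\<Prod>l\<in>UNIV. LINT t|lborel. \<eta> l t)"
    by (subst lborel_vec_eq_distr_PiM, subst integral_distr)
      (use lebesgue_product.product_integral_prod[of UNIV \<eta>] assms in auto)
qed

text \<open>Fubini with coordinate \<open>l\<close> as the outer variable; it turns marginal
  coefficients into expectations under the joint density.\<close>

lemma integral_marginal:
  fixes g :: "real ^ 'd \<Rightarrow> real"
  assumes [measurable]: "g \<in> borel_measurable borel" "h \<in> borel_measurable borel"
    and int: "integrable lborel (\<lambda>x. g x * h (x $ l))"
  shows "(LINT t|lborel. marginal g l t * h t) = (LINT x|lborel. g x * h (x $ l))"
proof -
  let ?f = "\<lambda>y. g (\<chi> i. y i) * h (y l)"
  have U: "{l} \<union> (UNIV - {l}) = UNIV" by auto
  have i: "integrable (Pi\<^sub>M ({l} \<union> (UNIV - {l})) (\<lambda>_. lborel)) ?f"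
    using int unfolding U by (subst (asm) lborel_vec_eq_distr_PiM, subst (asm) integrable_distr_eq) auto
  have [measurable]: "(\<lambda>(t :: real, y). \<chi> i. if i = l then t else y i) \<in>
      borel_measurable (borel \<Otimes>\<^sub>M Pi\<^sub>M (UNIV - {l}) (\<lambda>_. lborel))"
  proof -
    have "(\<lambda>z. if i = l then fst z else snd z i :: real) \<in>
        borel_measurable (borel \<Otimes>\<^sub>M Pi\<^sub>M (UNIV - {l}) (\<lambda>_. lborel))" for i :: 'd
      by (cases "i = l") auto
    then show ?thesis
      unfolding case_prod_beta by (intro measurable_vec_lambda)
  qed
  interpret J: finite_product_sigma_finite "\<lambda>_. lborel :: real measure" "UNIV - {l}"
    by standard auto
  have marg: "marginal g l \<in> borel_measurable borel"
    unfolding marginal_def[abs_def]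
    by (rule J.borel_measurable_lebesgue_integral) measurable
  have "(LINT x|lborel. g x * h (x $ l)) = (LINT y|Pi\<^sub>M ({l} \<union> (UNIV - {l})) (\<lambda>_. lborel). ?f y)"
    unfolding U by (subst lborel_vec_eq_distr_PiM, subst integral_distr) auto
  also have "\<dots> = (LINT y|Pi\<^sub>M {l} (\<lambda>_. lborel). LINT z|Pi\<^sub>M (UNIV - {l}) (\<lambda>_. lborel).
      ?f (merge {l} (UNIV - {l}) (y, z)))"
    by (rule lebesgue_product.product_integral_fold[OF _ _ _ i]) auto
  also have "\<dots> = (LINT y|Pi\<^sub>M {l} (\<lambda>_. lborel). marginal g l (y l) * h (y l))"
  proof -
    have "(\<chi> i. merge {l} (UNIV - {l}) (y, z) i) = (\<chi> i. if i = l then y l else z i)" for y z :: "'d \<Rightarrow> real"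
      by (simp add: vec_eq_iff merge_def)
    moreover have "merge {l} (UNIV - {l}) (y, z) l = y l" for y z :: "'d \<Rightarrow> real"
      by (simp add: merge_def)
    ultimately show ?thesis
      by (simp add: marginal_def)
  qed
  also have "\<dots> = (LINT t|lborel. marginal g l t * h t)"
    by (rule lebesgue_product.product_integral_singleton) (use marg in measurable)
  finally show ?thesis ..
qed

section \<open>Dilates and translates of the scaling function\<close>

lemma measurable_scaled [measurable]:
  assumes [measurable]: "\<phi> \<in> borel_measurable borel"
  shows "scaled \<phi> j m \<in> borel_measurable borel"
  unfolding scaled_def[abs_def] by measurable

lemma scaled_mult_scaled:
  "scaled \<phi> j m t * scaled \<phi> j m' t = 2 ^ j * (\<phi> (2 ^ j * t - of_int m) * \<phi> (2 ^ j * t - of_int m'))"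
proof -
  have "2 powr (real j / 2) * 2 powr (real j / 2) = (2 ^ j :: real)"
    by (simp add: powr_realpow flip: powr_add)
  then show ?thesis
    by (simp add: scaled_def)
qed

lemma integral_scaled_mult_scaled:
  "(LINT t|lborel. scaled \<phi> j m t * scaled \<phi> j m' t) =
    (LINT t|lborel. \<phi> (t - of_int m) * \<phi> (t - of_int m'))"
proof -
  have "(LINT t|lborel. \<phi> (t - of_int m) * \<phi> (t - of_int m')) =
      \<bar>2 ^ j\<bar> *\<^sub>R (LINT t|lborel. \<phi> (0 + 2 ^ j * t - of_int m) * \<phi> (0 + 2 ^ j * t - of_int m'))"
    by (rule lborel_integral_real_affine) simp
  then show ?thesis
    by (simp add: scaled_mult_scaled)
qed

text \<open>At any point at most \<open>2 * r + 1\<close> translates are nonzero, whatever the size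
  of \<open>F\<close>; the factor \<open>2 ^ j\<close> is the squared normalisation.\<close>

lemma sum_scaled_square_le:
  assumes \<phi>: "\<And>t. \<bar>\<phi> t\<bar> \<le> B" "\<And>t. \<phi> t \<noteq> 0 \<Longrightarrow> \<bar>t\<bar> \<le> r" and "0 \<le> r" "finite F"
  shows "(\<Sum>m\<in>F. (scaled \<phi> j m t)\<^sup>2) \<le> 2 ^ j * (B\<^sup>2 * (2 * r + 1))"
proof -
  define y where "y = 2 ^ j * t"
  let ?F = "{\<lceil>y - r\<rceil>..\<lfloor>y + r\<rfloor>}"
  have "(\<Sum>m\<in>F. (scaled \<phi> j m t)\<^sup>2) = 2 ^ j * (\<Sum>m\<in>F. (\<phi> (y - of_int m))\<^sup>2)"
    by (simp add: power2_eq_square scaled_mult_scaled y_def sum_distrib_left)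
  also have "(\<Sum>m\<in>F. (\<phi> (y - of_int m))\<^sup>2) = (\<Sum>m\<in>F \<inter> ?F. (\<phi> (y - of_int m))\<^sup>2)"
  proof (rule sum.mono_neutral_right[OF assms(4)])
    show "\<forall>m\<in>F - F \<inter> ?F. (\<phi> (y - real_of_int m))\<^sup>2 = 0"
    proof
      fix m assume "m \<in> F - F \<inter> ?F"
      then have "\<not> \<bar>y - real_of_int m\<bar> \<le> r"
        by (auto simp: ceiling_le_iff le_floor_iff)
      then show "(\<phi> (y - real_of_int m))\<^sup>2 = 0"
        using \<phi>(2) by auto
    qed
  qed auto
  also have "\<dots> \<le> (\<Sum>m\<in>F \<inter> ?F. B\<^sup>2)"
    by (intro sum_mono) (use power_mono[OF \<phi>(1), of _ 2] in simp)
  also have "\<dots> \<le> B\<^sup>2 * (2 * r + 1)"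
  proof -
    have "card (F \<inter> ?F) \<le> card ?F"
      by (intro card_mono) auto
    then have "real (card (F \<inter> ?F)) \<le> real (nat (\<lfloor>y + r\<rfloor> - \<lceil>y - r\<rceil> + 1))"
      by simp
    also have "\<dots> \<le> 2 * r + 1"
      using assms(3) by linarith
    finally show ?thesis
      by (simp add: mult.commute mult_left_mono)
  qed
  finally show ?thesis by simp
qed

lemma integrable_bounded_support:
  fixes h :: "real \<Rightarrow> real"
  assumes "h \<in> borel_measurable borel" "\<And>t. \<bar>h t\<bar> \<le> C" "\<And>t. h t \<noteq> 0 \<Longrightarrow> \<bar>t\<bar> \<le> \<rho>"
  shows "integrable lborel h"
proof (rule integrableI_bounded_set[of "{-\<rho>..\<rho>}"])
  show "AE t in lborel. t \<notin> {-\<rho>..\<rho>} \<longrightarrow> h t = 0"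
    using assms(3) by (intro AE_I2) (fastforce simp: abs_le_iff)
qed (use assms in \<open>auto simp: emeasure_lborel_Icc_eq\<close>)

lemma infsum_vec_box:
  fixes h :: "int ^ 'd \<Rightarrow> real"
  assumes "finite F" "\<And>k l. k $ l \<notin> F \<Longrightarrow> h k = 0"
  shows "(\<Sum>\<^sub>\<infinity>k\<in>UNIV. h k) = (\<Sum>k\<in>PiE UNIV (\<lambda>_. F). h (\<chi> l. k l))"
proof -
  let ?K = "PiE UNIV (\<lambda>_ :: 'd. F)"
  have fin: "finite ?K"
    using assms(1) by (intro finite_PiE) auto
  have "(\<Sum>\<^sub>\<infinity>k\<in>UNIV. h k) = (\<Sum>\<^sub>\<infinity>k\<in>vec_lambda ` ?K. h k)"
  proof (rule infsum_cong_neutral)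
    fix k :: "int ^ 'd"
    assume k: "k \<in> UNIV - vec_lambda ` ?K"
    have "k = vec_lambda (vec_nth k)" by simp
    then have "vec_nth k \<notin> ?K"
      using k by blast
    then show "h k = 0"
      using assms(2) by (auto simp: PiE_iff)
  qed auto
  also have "\<dots> = (\<Sum>k\<in>vec_lambda ` ?K. h k)"
    using fin by simp
  also have "\<dots> = (\<Sum>k\<in>?K. h (\<chi> l. k l))"
    by (subst sum.reindex) (auto simp: inj_on_def vec_lambda_inject)
  finally show ?thesis .
qed

section \<open>A compactly supported square-integrable density as an instance of the abstract
  model\<close>

locale wavelet_density =
  fixes g :: "real ^ 'd \<Rightarrow> real" and \<phi> :: "real \<Rightarrow> real" and B r R :: real
  assumes density: "is_density g"
    and g_square: "integrable lborel (\<lambda>x. (g x)\<^sup>2)"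
    and g_support: "\<And>x l. g x \<noteq> 0 \<Longrightarrow> \<bar>x $ l\<bar> \<le> R"
    and \<phi>_measurable [measurable]: "\<phi> \<in> borel_measurable borel"
    and \<phi>_bound: "\<And>t. \<bar>\<phi> t\<bar> \<le> B"
    and \<phi>_support: "\<And>t. \<phi> t \<noteq> 0 \<Longrightarrow> \<bar>t\<bar> \<le> r"
    and \<phi>_orthonormal: "\<And>m m' :: int. (LINT t|lborel. \<phi> (t - of_int m) * \<phi> (t - of_int m')) =
      (if m = m' then 1 else 0)"
    and r_nonneg: "0 \<le> r" and R_pos: "0 < R"
begin

abbreviation M :: "(real ^ 'd) measure" where "M \<equiv> density lborel (\<lambda>x. ennreal (g x))"

lemma g_measurable [measurable]: "g \<in> borel_measurable borel"
  and g_nonneg: "0 \<le> g x"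
  using density by (auto simp: is_density_def)

sublocale iid M
proof (rule iid.intro, rule prob_spaceI)
  show "emeasure M (space M) = 1"
    using density by (subst emeasure_density) (auto simp: is_density_def)
qed

lemma expectation_eq:
  assumes [measurable]: "h \<in> borel_measurable borel"
  shows "(LINT x|M. h x) = (LINT x|lborel. g x * h x)"
  by (subst integral_density) (auto simp: g_nonneg)

lemma integrable_eq:
  fixes h :: "real ^ 'd \<Rightarrow> real"
  assumes [measurable]: "h \<in> borel_measurable borel"
  shows "integrable M h \<longleftrightarrow> integrable lborel (\<lambda>x. g x * h x)"
  by (subst integrable_density) (auto simp: g_nonneg)

lemma scaled_abs_le: "\<bar>scaled \<phi> j m t\<bar> \<le> 2 powr (real j / 2) * B"
  using \<phi>_bound by (simp add: scaled_def abs_mult mult_left_mono)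

lemma scaled_support: "scaled \<phi> j m t \<noteq> 0 \<Longrightarrow> \<bar>of_int m\<bar> \<le> 2 ^ j * \<bar>t\<bar> + r"
proof -
  assume "scaled \<phi> j m t \<noteq> 0"
  then have "\<bar>2 ^ j * t - of_int m\<bar> \<le> r"
    by (intro \<phi>_support) (auto simp: scaled_def)
  moreover have "\<bar>2 ^ j * t\<bar> = 2 ^ j * \<bar>t\<bar>"
    by (simp add: abs_mult)
  ultimately show ?thesis by linarith
qed

lemma scaled_support': "scaled \<phi> j m t \<noteq> 0 \<Longrightarrow> \<bar>t\<bar> \<le> \<bar>of_int m\<bar> + r"
proof -
  assume "scaled \<phi> j m t \<noteq> 0"
  then have "\<bar>2 ^ j * t - of_int m\<bar> \<le> r"
    by (intro \<phi>_support) (auto simp: scaled_def)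
  moreover have "\<bar>2 ^ j * t\<bar> = 2 ^ j * \<bar>t\<bar>"
    by (simp add: abs_mult)
  moreover have "1 * \<bar>t\<bar> \<le> 2 ^ j * \<bar>t\<bar>"
    by (intro mult_right_mono) auto
  ultimately show ?thesis by linarith
qed

lemma integrable_scaled_product: "integrable lborel (\<lambda>t. scaled \<phi> j m t * scaled \<phi> j m' t)"
proof (rule integrable_bounded_support)
  have "0 \<le> 2 powr (real j / 2) * B"
    using scaled_abs_le[of j m 0] by linarith
  then show "\<bar>scaled \<phi> j m t * scaled \<phi> j m' t\<bar> \<le> (2 powr (real j / 2) * B) * (2 powr (real j / 2) * B)" for t
    unfolding abs_mult by (intro mult_mono scaled_abs_le) auto
  show "\<bar>t\<bar> \<le> \<bar>of_int m\<bar> + r" if "scaled \<phi> j m t * scaled \<phi> j m' t \<noteq> 0" for t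
    using that by (intro scaled_support') auto
qed measurable

lemma scaled_orthonormal:
  "(LINT t|lborel. scaled \<phi> j m t * scaled \<phi> j m' t) = (if m = m' then 1 else 0)"
  unfolding integral_scaled_mult_scaled by (rule \<phi>_orthonormal)

definition b0 :: real where "b0 = max 1 (B\<^sup>2 * (2 * r + 1))"

text \<open>Dominates 1 and both Bessel bounds: the joint one, with squared norm 1, and the marginal
  one, with squared norm \<open>(2 * R) ^ (CARD('d) - 1)\<close>.\<close>

definition G :: real where
  "G = 1 + (1 + (2 * R) ^ (CARD('d) - 1)) * (LINT x|lborel. (g x)\<^sup>2)"

lemma b0_ge: "1 \<le> b0"
  by (simp add: b0_def)

lemma g_square_nonneg: "0 \<le> (LINT x|lborel. (g x)\<^sup>2)"
  by (rule integral_nonneg_AE) simp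

lemma G_bounds:
  "1 \<le> G" "(LINT x|lborel. (g x)\<^sup>2) \<le> G" "(2 * R) ^ (CARD('d) - 1) * (LINT x|lborel. (g x)\<^sup>2) \<le> G"
proof -
  have "0 \<le> (2 * R) ^ (CARD('d) - 1) * (LINT x|lborel. (g x)\<^sup>2)"
    using R_pos g_square_nonneg by simp
  then show "1 \<le> G" "(LINT x|lborel. (g x)\<^sup>2) \<le> G"
      "(2 * R) ^ (CARD('d) - 1) * (LINT x|lborel. (g x)\<^sup>2) \<le> G"
    using g_square_nonneg by (auto simp: G_def distrib_right)
qed

lemma tensor_abs_le:
  "\<bar>\<Prod>l\<in>UNIV. scaled \<phi> j (k l) (x $ l)\<bar> \<le> (2 powr (real j / 2) * B) ^ CARD('d)" for x :: "real ^ 'd"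
proof -
  have "\<bar>\<Prod>l\<in>UNIV. scaled \<phi> j (k l) (x $ l)\<bar> \<le> (\<Prod>l\<in>(UNIV :: 'd set). 2 powr (real j / 2) * B)"
    unfolding abs_prod by (intro prod_mono conjI scaled_abs_le) auto
  then show ?thesis by simp
qed

text \<open>Bessel's inequality: by Fubini, tensor products of an orthonormal system are
  orthonormal.\<close>

lemma joint_coefficients_le:
  assumes "finite F"
  shows "(\<Sum>k\<in>PiE UNIV (\<lambda>_. F). (LINT x|M. (\<Prod>l\<in>UNIV. scaled \<phi> j (k l) (x $ l)))\<^sup>2) \<le> G"
proof -
  let ?t = "\<lambda>k (x :: real ^ 'd). \<Prod>l\<in>UNIV. scaled \<phi> j (k l) (x $ l)"
  have prod: "?t k x * ?t k' x = (\<Prod>l\<in>UNIV. scaled \<phi> j (k l) (x $ l) * scaled \<phi> j (k' l) (x $ l))" for k k' x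
    by (simp add: prod.distrib)
  have "(\<Sum>k\<in>PiE UNIV (\<lambda>_. F). (LINT x|lborel. g x * ?t k x)\<^sup>2) \<le> 1 * (LINT x|lborel. (g x)\<^sup>2)"
  proof (rule bessel_inequality)
    show "finite (PiE UNIV (\<lambda>_ :: 'd. F))"
      using assms by (intro finite_PiE) auto
    show "integrable lborel (\<lambda>x. g x * ?t k x)" for k
      by (subst integrable_eq[symmetric]) (auto intro!: integrable_bounded tensor_abs_le)
    show "integrable lborel (\<lambda>x. ?t k x * ?t k' x)" for k k'
      unfolding prod by (rule integral_lborel_vec_prod(1)) (rule integrable_scaled_product)
    show "(LINT x|lborel. ?t k x * ?t k' x) = (if k = k' then 1 else 0)" for k k'
    proof -
      have "(LINT x|lborel. ?t k x * ?t k' x) = (\<Prod>l\<in>UNIV. if k l = k' l then 1 else 0)"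
        unfolding prod by (subst integral_lborel_vec_prod(2))
          (simp_all only: integrable_scaled_product scaled_orthonormal)
      then show ?thesis
        by (auto simp: fun_eq_iff)
    qed
  qed (use g_square in auto)
  then show ?thesis
    using G_bounds(2) by (simp add: expectation_eq)
qed

text \<open>A function of one coordinate alone need not be square integrable on the whole space.
  Multiplying it by indicators of \<open>{-R..R}\<close> in the other coordinates leaves its
  integral against \<open>g\<close> unchanged, by the support of \<open>g\<close>, and gives an
  orthogonal family to which Bessel's inequality applies.\<close>

lemma marginal_coefficients_le:
  assumes "finite F"
  shows "(\<Sum>m\<in>F. (LINT x|M. scaled \<phi> j m (x $ l))\<^sup>2) \<le> G"
proof -
  let ?h = "\<lambda>m l' t. if l' = l then scaled \<phi> j m t else indicator {-R..R} t"
  let ?t = "\<lambda>m (x :: real ^ 'd). \<Prod>l'\<in>UNIV. ?h m l' (x $ l')"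
  have t: "?t m x = scaled \<phi> j m (x $ l) * (\<Prod>l'\<in>UNIV - {l}. indicator {-R..R} (x $ l'))" for m x
    by (subst prod.remove[of _ l]) auto
  have gt: "g x * ?t m x = g x * scaled \<phi> j m (x $ l)" for m x
  proof (cases "g x = 0")
    case False
    then have "x $ l' \<in> {-R..R}" for l'
      using g_support[of x l'] by (auto simp: abs_le_iff)
    then have "(\<Prod>l'\<in>UNIV - {l}. indicator {-R..R} (x $ l')) = (1 :: real)"
      by simp
    then show ?thesis by (simp only: t mult_1_right)
  qed simp
  let ?p = "\<lambda>m m' l' t. if l' = l then scaled \<phi> j m t * scaled \<phi> j m' t else indicator {-R..R} t"
  have prod: "?t m x * ?t m' x = (\<Prod>l'\<in>UNIV. ?p m m' l' (x $ l'))" for m m' x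
    unfolding prod.distrib[symmetric] by (intro prod.cong) (auto simp: indicator_def)
  have int_p: "integrable lborel (?p m m' l')" for m m' l'
    by (cases "l' = l") (auto simp: integrable_scaled_product emeasure_lborel_Icc_eq)
  have "(\<Sum>m\<in>F. (LINT x|lborel. g x * ?t m x)\<^sup>2) \<le> (2 * R) ^ (CARD('d) - 1) * (LINT x|lborel. (g x)\<^sup>2)"
  proof (rule bessel_inequality)
    show "integrable lborel (\<lambda>x. g x * ?t m x)" for m
      unfolding gt
      by (subst integrable_eq[symmetric]) (auto intro!: integrable_bounded scaled_abs_le)
    show "integrable lborel (\<lambda>x. ?t m x * ?t m' x)" for m m'
      unfolding prod by (rule integral_lborel_vec_prod(1)) (rule int_p)
    show "(LINT x|lborel. ?t m x * ?t m' x) = (if m = m' then (2 * R) ^ (CARD('d) - 1) else 0)" for m m'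
    proof -
      have "(LINT x|lborel. ?t m x * ?t m' x) = (\<Prod>l'\<in>UNIV. LINT t|lborel. ?p m m' l' t)"
        unfolding prod by (rule integral_lborel_vec_prod(2)) (rule int_p)
      also have "\<dots> = (\<Prod>l'\<in>UNIV. if l' = l then (if m = m' then 1 else 0) else 2 * R)"
        using R_pos by (intro prod.cong) (auto simp: scaled_orthonormal)
      also have "\<dots> = (if m = m' then 1 else 0) * (\<Prod>l'\<in>UNIV - {l}. 2 * R)"
        by (subst prod.remove[of _ l]) auto
      finally show ?thesis
        by (simp add: card_Diff_singleton)
    qed
  qed (use g_square assms R_pos in auto)
  then show ?thesis
    using G_bounds(3) unfolding gt by (simp add: expectation_eq)
qed

abbreviation \<psi> :: "nat \<Rightarrow> 'd \<Rightarrow> int \<Rightarrow> real ^ 'd \<Rightarrow> real" where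
  "\<psi> j \<equiv> \<lambda>l m x. scaled \<phi> j m (x $ l)"

text \<open>The level enters the bounds through \<open>2 ^ j * b0\<close> alone; \<open>G\<close> is
  the same for all levels and boxes, which makes the final constants uniform.\<close>

lemma contrast_model:
  assumes "finite F"
  shows "contrast_model M (\<psi> j) F (2 ^ j * b0) G"
proof
  show "(\<Sum>m\<in>F. (\<psi> j l m x)\<^sup>2) \<le> 2 ^ j * b0" for l x
  proof -
    have "(\<Sum>m\<in>F. (\<psi> j l m x)\<^sup>2) \<le> 2 ^ j * (B\<^sup>2 * (2 * r + 1))"
      by (rule sum_scaled_square_le[OF \<phi>_bound \<phi>_support r_nonneg assms])
    also have "\<dots> \<le> 2 ^ j * b0"
      by (intro mult_left_mono) (auto simp: b0_def)
    finally show ?thesis .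
  qed
  show "1 \<le> 2 ^ j * b0"
    using mult_mono[of 1 "2 ^ j" 1 b0] b0_ge by simp
qed (use assms in \<open>auto simp: G_bounds marginal_coefficients_le joint_coefficients_le\<close>)

text \<open>Observations in a cube of half-side \<open>\<rho>\<close> meet only translates with
  index at most \<open>2 ^ j * \<rho> + r\<close> in absolute value, so the infinite sum reduces to
  a box.\<close>

lemma contrast_estimator_eq:
  assumes "\<And>i l. i < n \<Longrightarrow> \<bar>X i $ l\<bar> \<le> \<rho>" "2 ^ j * \<rho> + r \<le> of_int N"
  shows "contrast_estimator \<phi> n j X = contrast_model.estimator (\<psi> j) {-N..N} n X"
proof -
  interpret C: contrast_model M "\<psi> j" "{-N..N}" "2 ^ j * b0" G
    by (rule contrast_model) simp
  have zero: "scaled \<phi> j m (X i $ l) = 0" if "i < n" "m \<notin> {-N..N}" for i m l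
  proof (rule ccontr)
    assume "scaled \<phi> j m (X i $ l) \<noteq> 0"
    from scaled_support[OF this] have "\<bar>of_int m\<bar> \<le> 2 ^ j * \<bar>X i $ l\<bar> + r" .
    also have "\<dots> \<le> 2 ^ j * \<rho> + r"
      using assms(1)[OF that(1)] by simp
    finally have "\<bar>of_int m\<bar> \<le> (of_int N :: real)"
      using assms(2) by linarith
    then show False
      using that(2) by auto
  qed
  have est0: "est_coeff \<phi> n j X k = 0" "(\<Prod>l\<in>UNIV. est_marginal_coeff \<phi> n j X l (k $ l)) = 0"
    if "k $ l \<notin> {-N..N}" for k :: "int ^ 'd" and l
  proof -
    have "tensor_scaled \<phi> j k (X i) = 0" if "i < n" for i
      unfolding tensor_scaled_def using zero[OF that \<open>k $ l \<notin> _\<close>] by (intro prod_zero) auto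
    then show "est_coeff \<phi> n j X k = 0"
      by (simp add: est_coeff_def)
    have "est_marginal_coeff \<phi> n j X l (k $ l) = 0"
      using zero[OF _ that] by (simp add: est_marginal_coeff_def)
    then show "(\<Prod>l\<in>UNIV. est_marginal_coeff \<phi> n j X l (k $ l)) = 0"
      by (intro prod_zero) auto
  qed
  have "contrast_estimator \<phi> n j X = (\<Sum>k\<in>PiE UNIV (\<lambda>_. {-N..N}).
      (est_coeff \<phi> n j X (\<chi> l. k l) - (\<Prod>l\<in>UNIV. est_marginal_coeff \<phi> n j X l ((\<chi> l. k l) $ l)))\<^sup>2)"
    unfolding contrast_estimator_def
    by (rule infsum_vec_box) (simp_all only: est0, simp_all)
  then show ?thesis
    by (simp add: C.estimator_def est_coeff_def est_marginal_coeff_def tensor_scaled_def)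
qed

lemma marginal_coeff_eq: "marginal_coeff \<phi> g j l m = (LINT x|M. \<psi> j l m x)"
proof -
  have "integrable lborel (\<lambda>x. g x * scaled \<phi> j m (x $ l))"
    by (subst integrable_eq[symmetric]) (auto intro!: integrable_bounded scaled_abs_le)
  then show ?thesis
    unfolding marginal_coeff_def by (subst integral_marginal) (auto simp: expectation_eq)
qed

lemma coeff_eq: "coeff \<phi> g j k = (LINT x|M. (\<Prod>l\<in>UNIV. \<psi> j l (k $ l) x))"
  by (simp add: coeff_def tensor_scaled_def expectation_eq)

lemma wavelet_contrast_eq:
  assumes "2 ^ j * R + r \<le> of_int N"
  shows "wavelet_contrast \<phi> g j = contrast_model.contrast M (\<psi> j) {-N..N}"
proof -
  interpret C: contrast_model M "\<psi> j" "{-N..N}" "2 ^ j * b0" G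
    by (rule contrast_model) simp
  have zero: "g x * scaled \<phi> j m (x $ l) = 0" if "m \<notin> {-N..N}" for x m l
  proof (rule ccontr)
    assume *: "g x * scaled \<phi> j m (x $ l) \<noteq> 0"
    then have "\<bar>of_int m\<bar> \<le> 2 ^ j * \<bar>x $ l\<bar> + r"
      by (intro scaled_support) auto
    also have "\<dots> \<le> 2 ^ j * R + r"
      using * g_support[of x l] by simp
    finally have "\<bar>of_int m\<bar> \<le> (of_int N :: real)"
      using assms by linarith
    then show False
      using that by auto
  qed
  have c0: "coeff \<phi> g j k = 0" "(\<Prod>l\<in>UNIV. marginal_coeff \<phi> g j l (k $ l)) = 0"
    if "k $ l \<notin> {-N..N}" for k :: "int ^ 'd" and l
  proof -
    have "g x * tensor_scaled \<phi> j k x = 0" for x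
      unfolding tensor_scaled_def using zero[OF that, of x l] by (cases "g x = 0") (auto intro!: prod_zero)
    then show "coeff \<phi> g j k = 0"
      by (simp only: coeff_def Bochner_Integration.integral_zero)
    have "marginal_coeff \<phi> g j l (k $ l) = 0"
      by (simp add: marginal_coeff_eq expectation_eq zero[OF that])
    then show "(\<Prod>l\<in>UNIV. marginal_coeff \<phi> g j l (k $ l)) = 0"
      by (intro prod_zero) auto
  qed
  have "wavelet_contrast \<phi> g j = (\<Sum>k\<in>PiE UNIV (\<lambda>_. {-N..N}).
      (coeff \<phi> g j (\<chi> l. k l) - (\<Prod>l\<in>UNIV. marginal_coeff \<phi> g j l ((\<chi> l. k l) $ l)))\<^sup>2)"
    unfolding wavelet_contrast_def
    by (rule infsum_vec_box) (simp_all only: c0, simp_all)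
  then show ?thesis
    by (simp add: C.contrast_def C.defect_def coeff_eq marginal_coeff_eq)
qed

text \<open>No single box serves all samples, but for each sample the box estimators are eventually
  equal to the full one as the box grows; the latter is thus a pointwise limit.\<close>

lemma measurable_contrast_estimator [measurable]:
  "contrast_estimator \<phi> n j \<in> borel_measurable (law n)"
proof (rule borel_measurable_LIMSEQ_real)
  fix N :: nat
  interpret C: contrast_model M "\<psi> j" "{-int N..int N}" "2 ^ j * b0" G
    by (rule contrast_model) simp
  show "contrast_model.estimator (\<psi> j) {-int N..int N} n \<in> borel_measurable (law n)"
    by measurable
next
  fix X :: "nat \<Rightarrow> real ^ 'd"
  define \<rho> where "\<rho> = (\<Sum>i<n. norm (X i))"
  have X: "\<bar>X i $ l\<bar> \<le> \<rho>" if "i < n" for i l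
  proof -
    have "\<bar>X i $ l\<bar> \<le> norm (X i)" by (rule component_le_norm_cart)
    also have "\<dots> \<le> \<rho>"
      unfolding \<rho>_def using that by (intro member_le_sum) auto
    finally show ?thesis .
  qed
  have "eventually (\<lambda>N. 2 ^ j * \<rho> + r \<le> real N) sequentially"
    using filterlim_real_sequentially unfolding filterlim_at_top by blast
  then have "eventually (\<lambda>N. contrast_model.estimator (\<psi> j) {-int N..int N} n X =
      contrast_estimator \<phi> n j X) sequentially"
    by eventually_elim (rule contrast_estimator_eq[symmetric, OF X], auto)
  then show "(\<lambda>N. contrast_model.estimator (\<psi> j) {-int N..int N} n X) \<longlonglongrightarrow> contrast_estimator \<phi> n j X"
    by (rule tendsto_eventually)
qed

lemma AE_sample_bounded: "AE X in law n. \<forall>i<n. \<forall>l. \<bar>X i $ l\<bar> \<le> R"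
proof -
  have "AE x in M. \<forall>l. \<bar>x $ l\<bar> \<le> R"
    using g_support by (subst AE_density) (auto simp: ennreal_less_zero_iff)
  then have "AE X in law n. \<forall>l. \<bar>X i $ l\<bar> \<le> R" if "i < n" for i
    using that prob_space_axioms by (intro AE_PiM_component) auto
  then have "AE X in law n. \<forall>i\<in>{..<n}. \<forall>l. \<bar>X i $ l\<bar> \<le> R"
    by (intro AE_finite_allI) auto
  then show ?thesis
    by eventually_elim auto
qed

end

subsection \<open>Convergence rates\<close>

context wavelet_density
begin

definition bias_const :: real where
  "bias_const = 8 + (2 * 4 ^ CARD('d) + 8 * 2 ^ CARD('d) * G ^ CARD('d)) *
     (real CARD('d) * G ^ CARD('d) * 4 ^ CARD('d))"

definition error_const :: real where
  "error_const = 8 + 2 * 4 ^ CARD('d) * (real CARD('d) * G ^ CARD('d) * 4 ^ CARD('d))"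

definition error_square_const :: real where
  "error_square_const = 512 + 32 * 16 ^ CARD('d) * (real CARD('d) * G ^ CARD('d) * 4 ^ CARD('d))\<^sup>2"

definition risk_const :: real where
  "risk_const = 2 * (error_square_const * (b0 ^ CARD('d))\<^sup>2) +
     32 * G ^ CARD('d) * (error_const * b0 ^ CARD('d))"

lemma power_G_ge: "1 \<le> G ^ CARD('d)"
  using G_bounds(1) by simp

lemma const_nonneg: "0 \<le> bias_const" "0 \<le> error_const" "0 \<le> error_square_const" "0 \<le> risk_const"
  using G_bounds(1) b0_ge
  by (auto simp: bias_const_def error_const_def error_square_const_def risk_const_def
      intro!: add_nonneg_nonneg mult_nonneg_nonneg)

abbreviation (input) C :: "nat \<Rightarrow> real" where "C \<equiv> wavelet_contrast \<phi> g"

abbreviation (input) Chat :: "nat \<Rightarrow> nat \<Rightarrow> (nat \<Rightarrow> real ^ 'd) \<Rightarrow> real" where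
  "Chat \<equiv> contrast_estimator \<phi>"

context
  fixes n j :: nat
  assumes n: "n \<ge> 1"
begin

text \<open>Everything is transported from the finite box model, whose estimator agrees with the
  full one almost surely and whose contrast agrees exactly.\<close>

lemma contrast_bounds: "0 \<le> C j" "C j \<le> 4 * G ^ CARD('d)"
  and integrable_estimator: "integrable (law n) (Chat n j)" "integrable (law n) (\<lambda>X. (Chat n j X)\<^sup>2)"
  and bias_rate: "\<bar>(LINT X|law n. Chat n j X) - C j\<bar> \<le> bias_const * b0 ^ CARD('d) * (2 ^ (j * CARD('d)) / real n)"
  and risk_rate: "2 ^ (j * CARD('d)) \<le> n \<Longrightarrow> (LINT X|law n. (Chat n j X - C j)\<^sup>2) \<le> risk_const * (2 ^ (j * CARD('d)) / real n)"
proof -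
  let ?rate = "2 ^ (j * CARD('d)) / real n"
  \<comment> \<open>One box, independent of the sample, large enough both for the support of the
    density and for almost every sample.\<close>
  define N where "N = \<lceil>2 ^ j * R + r\<rceil>"
  have N: "2 ^ j * R + r \<le> of_int N"
    by (simp add: N_def)
  interpret S: contrast_model M "\<psi> j" "{-N..N}" "2 ^ j * b0" G
    by (rule contrast_model) simp
  have C: "C j = S.contrast"
    by (rule wavelet_contrast_eq[OF N])
  have ae: "AE X in law n. Chat n j X = S.estimator n X"
    using AE_sample_bounded by eventually_elim (rule contrast_estimator_eq[OF _ N], auto)
  have int_cong: "integrable (law n) (\<lambda>X. f (Chat n j X))" "(LINT X|law n. f (Chat n j X)) = (LINT X|law n. f (S.estimator n X))"
    if "integrable (law n) (\<lambda>X. f (S.estimator n X))" and [measurable]: "f \<in> borel_measurable borel" for f :: "real \<Rightarrow> real"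
  proof -
    have ae': "AE X in law n. f (Chat n j X) = f (S.estimator n X)"
      using ae by eventually_elim simp
    show "integrable (law n) (\<lambda>X. f (Chat n j X))"
      using that(1) by (subst integrable_cong_AE[OF _ _ ae']) auto
    show "(LINT X|law n. f (Chat n j X)) = (LINT X|law n. f (S.estimator n X))"
      by (rule integral_cong_AE[OF _ _ ae']) auto
  qed
  note int = S.integrable_estimator[OF n]
  show "0 \<le> C j" "C j \<le> 4 * G ^ CARD('d)"
    unfolding C by (rule S.contrast_nonneg, rule S.contrast_le)
  show "integrable (law n) (Chat n j)" "integrable (law n) (\<lambda>X. (Chat n j X)\<^sup>2)"
    using int_cong(1)[of "\<lambda>x. x"] int_cong(1)[of "\<lambda>x. x\<^sup>2"] int by auto
  have b: "(2 ^ j * b0) ^ CARD('d) / real n = b0 ^ CARD('d) * ?rate"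
    by (simp add: power_mult_distrib power_mult)
  have "\<bar>(LINT X|law n. Chat n j X) - C j\<bar> \<le> bias_const * ((2 ^ j * b0) ^ CARD('d) / real n)"
    using S.bias_le[OF n] int_cong(2)[of "\<lambda>x. x"] int(1) unfolding C bias_const_def by simp
  then show "\<bar>(LINT X|law n. Chat n j X) - C j\<bar> \<le> bias_const * b0 ^ CARD('d) * ?rate"
    unfolding b by (simp only: mult.assoc)
  \<comment> \<open>The second moment of \<open>error\<close> contributes the square of the rate;
    when the rate is at most 1, this is absorbed into the rate itself.\<close>
  assume le: "2 ^ (j * CARD('d)) \<le> n"
  have "real (2 ^ (j * CARD('d))) \<le> real n"
    using le by (simp only: of_nat_le_iff)
  then have "?rate \<le> 1"
    using n by (simp add: divide_le_eq_1)
  then have "?rate * ?rate \<le> 1 * ?rate"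
    by (intro mult_right_mono) auto
  then have rate2: "?rate\<^sup>2 \<le> ?rate"
    by (simp add: power2_eq_square)
  have "(LINT X|law n. (S.error n X)\<^sup>2) \<le> error_square_const * (b0 ^ CARD('d) * ?rate)\<^sup>2"
    using S.expectation_error_square[OF n] unfolding b error_square_const_def .
  also have "\<dots> = error_square_const * (b0 ^ CARD('d))\<^sup>2 * ?rate\<^sup>2"
    by (simp only: power_mult_distrib mult.assoc)
  also have "\<dots> \<le> error_square_const * (b0 ^ CARD('d))\<^sup>2 * ?rate"
    using const_nonneg by (intro mult_left_mono rate2) auto
  finally have err2: "(LINT X|law n. (S.error n X)\<^sup>2) \<le> error_square_const * (b0 ^ CARD('d))\<^sup>2 * ?rate" .
  have err1: "(LINT X|law n. S.error n X) \<le> error_const * (b0 ^ CARD('d) * ?rate)"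
    using S.expectation_error[OF n] unfolding b error_const_def .
  have "(LINT X|law n. (Chat n j X - C j)\<^sup>2) = (LINT X|law n. (S.estimator n X - S.contrast)\<^sup>2)"
    using int_cong(2)[of "\<lambda>x. (x - S.contrast)\<^sup>2"] int(3) unfolding C by simp
  also have "\<dots> \<le> 2 * (LINT X|law n. (S.error n X)\<^sup>2) + 32 * G ^ CARD('d) * (LINT X|law n. S.error n X)"
    by (rule S.risk_le[OF n])
  also have "\<dots> \<le> 2 * (error_square_const * (b0 ^ CARD('d))\<^sup>2 * ?rate) +
      32 * G ^ CARD('d) * (error_const * (b0 ^ CARD('d) * ?rate))"
    using power_G_ge by (intro add_mono mult_left_mono err1 err2) auto
  also have "\<dots> = risk_const * ?rate"
    unfolding risk_const_def by (simp only: distrib_right mult.assoc)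
  finally show "(LINT X|law n. (Chat n j X - C j)\<^sup>2) \<le> risk_const * ?rate" .
qed

text \<open>Applied with \<open>t\<close> the contrast and with \<open>t\<close> the mean of the
  estimator, to compare risk, variance and second moment.\<close>

lemma risk_decomposition:
  "(LINT X|law n. (Chat n j X - t)\<^sup>2) = (LINT X|law n. (Chat n j X)\<^sup>2) - 2 * t * (LINT X|law n. Chat n j X) + t\<^sup>2"
proof -
  interpret L: prob_space "law n" by (rule prob_space_law)
  have "(LINT X|law n. (Chat n j X - t)\<^sup>2) = (LINT X|law n. (Chat n j X)\<^sup>2 - 2 * t * Chat n j X + t\<^sup>2)"
    by (simp add: power2_diff algebra_simps)
  also have "\<dots> = (LINT X|law n. (Chat n j X)\<^sup>2) - 2 * t * (LINT X|law n. Chat n j X) + t\<^sup>2"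
    using integrable_estimator by (simp add: L.prob_space)
  finally show ?thesis .
qed

text \<open>The risk exceeds the variance by the squared bias.\<close>

lemma variance_rate:
  assumes "2 ^ (j * CARD('d)) \<le> n"
  shows "(LINT X|law n. (Chat n j X - (LINT Y|law n. Chat n j Y))\<^sup>2) \<le> risk_const * (2 ^ (j * CARD('d)) / real n)"
proof -
  let ?m = "LINT Y|law n. Chat n j Y"
  have "0 \<le> (?m - C j)\<^sup>2" by simp
  then have "(LINT X|law n. (Chat n j X - ?m)\<^sup>2) \<le> (LINT X|law n. (Chat n j X - C j)\<^sup>2)"
    unfolding risk_decomposition by (simp add: power2_eq_square algebra_simps)
  then show ?thesis
    using risk_rate[OF assms] by linarith
qed

text \<open>The difference is the risk plus \<open>2 * C j\<close> times the bias, and the contrast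
  is bounded uniformly in the level.\<close>

lemma second_moment_rate:
  assumes "2 ^ (j * CARD('d)) \<le> n"
  shows "\<bar>(LINT X|law n. (Chat n j X)\<^sup>2) - (C j)\<^sup>2\<bar> \<le>
    (risk_const + 8 * G ^ CARD('d) * (bias_const * b0 ^ CARD('d))) * (2 ^ (j * CARD('d)) / real n)"
proof -
  let ?rate = "2 ^ (j * CARD('d)) / real n"
  let ?m = "LINT Y|law n. Chat n j Y"
  have eq: "(LINT X|law n. (Chat n j X)\<^sup>2) - (C j)\<^sup>2 = (LINT X|law n. (Chat n j X - C j)\<^sup>2) + 2 * C j * (?m - C j)"
    unfolding risk_decomposition by (simp add: power2_eq_square algebra_simps)
  have "0 \<le> (LINT X|law n. (Chat n j X - C j)\<^sup>2)"
    by (rule integral_nonneg_AE) simp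
  then have "\<bar>(LINT X|law n. (Chat n j X)\<^sup>2) - (C j)\<^sup>2\<bar> \<le>
      (LINT X|law n. (Chat n j X - C j)\<^sup>2) + \<bar>2 * C j * (?m - C j)\<bar>"
    unfolding eq by linarith
  also have "\<bar>2 * C j * (?m - C j)\<bar> = 2 * C j * \<bar>?m - C j\<bar>"
    using contrast_bounds by (simp add: abs_mult)
  also have "\<dots> \<le> 2 * (4 * G ^ CARD('d)) * (bias_const * b0 ^ CARD('d) * ?rate)"
    using contrast_bounds by (intro mult_mono bias_rate) auto
  also have "(LINT X|law n. (Chat n j X - C j)\<^sup>2) \<le> risk_const * ?rate"
    by (rule risk_rate[OF assms])
  finally show ?thesis
    by (simp add: algebra_simps)
qed

end

end

section \<open>From the hypotheses to the convergence rates\<close>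

lemma compactly_supportedE:
  assumes "compactly_supported f"
  obtains R where "0 < R" "\<And>x. f x \<noteq> 0 \<Longrightarrow> norm x \<le> R"
proof -
  have "bounded {x. f x \<noteq> 0}"
    using assms unfolding compactly_supported_def
    by (meson bounded_subset closure_subset compact_imp_bounded)
  then show ?thesis
    using that unfolding bounded_pos by blast
qed

lemma scaling_functionD:
  assumes "scaling_function \<phi>"
  shows "\<phi> \<in> borel_measurable borel"
    and "(LINT t|lborel. \<phi> (t - of_int m) * \<phi> (t - of_int m')) = (if m = m' then 1 else 0)"
proof -
  obtain V where V: "multiresolution_analysis V \<phi>"
    using assms by (auto simp: scaling_function_def)
  then have o: "orthonormal_basis_of_translates (V 0) \<phi>" and c: "closed_L2_subspace (V 0)"
    by (auto simp: multiresolution_analysis_def)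
  have "(\<lambda>x. \<phi> (x - of_int 0)) \<in> V 0"
    using o unfolding orthonormal_basis_of_translates_def by blast
  then have "square_integrable \<phi>"
    using c by (simp add: closed_L2_subspace_def)
  then show "\<phi> \<in> borel_measurable borel"
    by (simp add: square_integrable_def)
  show "(LINT t|lborel. \<phi> (t - of_int m) * \<phi> (t - of_int m')) = (if m = m' then 1 else 0)"
    using o unfolding orthonormal_basis_of_translates_def by blast
qed

text \<open>\<open>K\<close> precedes \<open>j\<close> and \<open>n\<close>, which expresses
  uniformity of the implied constants. The condition \<open>2 ^ (j * CARD('d)) \<le> n\<close>
  describes the regime in which the rate is at most 1. Square integrability of the density provides
  the Bessel bounds.\<close>

theorem proposition4p4:
  fixes A :: "real ^ 'd ^ 'd"
    and f :: "real ^ 'd \<Rightarrow> real"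
    and \<phi> :: "real \<Rightarrow> real"
    and s :: real
    and p q :: ennreal
  defines "fA \<equiv> mixed_density A f"
  defines "C \<equiv> wavelet_contrast \<phi> fA"
  defines "Chat \<equiv> contrast_estimator \<phi>"
  defines "P \<equiv> (\<lambda>n. sample_law n fA)"
  assumes "is_density f" and "product_of_marginals f" and "invertible A"
    and "compactly_supported fA"
    and "s > 0" and "1 \<le> p" and "1 \<le> q" and "fA \<in> besov_space s p q"
    and "square_integrable fA"
    and "scaling_function \<phi>" and "compactly_supported \<phi>" and "bounded (range \<phi>)"
  shows "\<exists>K. \<forall>j n. n \<ge> 1 \<longrightarrow>
    integrable (P n) (\<lambda>X. (Chat n j X)\<^sup>2) \<and>
    \<bar>(LINT X|P n. Chat n j X) - C j\<bar> \<le> K * (2 ^ (j * CARD('d)) / real n) \<and>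
    (2 ^ (j * CARD('d)) \<le> n \<longrightarrow>
      (LINT X|P n. (Chat n j X - C j)\<^sup>2) \<le> K * (2 ^ (j * CARD('d)) / real n) \<and>
      (LINT X|P n. (Chat n j X - (LINT Y|P n. Chat n j Y))\<^sup>2) \<le> K * (2 ^ (j * CARD('d)) / real n) \<and>
      \<bar>(LINT X|P n. (Chat n j X)\<^sup>2) - (C j)\<^sup>2\<bar> \<le> K * (2 ^ (j * CARD('d)) / real n))"
proof -
  obtain R where R: "0 < R" "\<And>x. fA x \<noteq> 0 \<Longrightarrow> norm x \<le> R"
    using compactly_supportedE[OF \<open>compactly_supported fA\<close>] by blast
  obtain r where r: "0 < r" "\<And>t. \<phi> t \<noteq> 0 \<Longrightarrow> norm t \<le> r"
    using compactly_supportedE[OF \<open>compactly_supported \<phi>\<close>] by blast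
  obtain B where B: "\<And>t. \<bar>\<phi> t\<bar> \<le> B"
    using \<open>bounded (range \<phi>)\<close> unfolding bounded_iff by auto
  interpret wavelet_density fA \<phi> B r R
  proof
    show "is_density fA"
      unfolding fA_def by (rule is_density_mixed_density) fact+
    show "integrable lborel (\<lambda>x. (fA x)\<^sup>2)"
      using \<open>square_integrable fA\<close> by (simp add: square_integrable_def)
    show "\<bar>x $ l\<bar> \<le> R" if "fA x \<noteq> 0" for x l
      using component_le_norm_cart[of x l] R(2)[OF that] by linarith
  qed (use R r B scaling_functionD[OF \<open>scaling_function \<phi>\<close>] in auto)
  have P: "P n = law n" for n
    by (simp add: P_def sample_law_def)
  let ?g = "G ^ CARD('d)" and ?b = "bias_const * b0 ^ CARD('d)"
  \<comment> \<open>A sum of nonnegative terms, so that it dominates the constants of all four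
    rates.\<close>
  define K where "K = risk_const + (8 * ?g * ?b + ?b)"
  have "0 \<le> ?b"
    using const_nonneg b0_ge by simp
  then have "0 \<le> 8 * ?g * ?b"
    using power_G_ge by (intro mult_nonneg_nonneg[of "8 * ?g"]) auto
  with \<open>0 \<le> ?b\<close> have K: "?b \<le> K" "risk_const \<le> K" "risk_const + 8 * ?g * ?b \<le> K"
    using const_nonneg by (auto simp: K_def)
  have scale: "x \<le> K * (2 ^ (j * CARD('d)) / real n)"
    if "x \<le> c * (2 ^ (j * CARD('d)) / real n)" "c \<le> K" for x c j and n :: nat
    using that(1) mult_right_mono[OF that(2), of "2 ^ (j * CARD('d)) / real n"]
    by (meson divide_nonneg_nonneg of_nat_0_le_iff order_trans zero_le_numeral zero_le_power)
  show ?thesis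
    unfolding P C_def Chat_def
    by (intro exI[of _ K] allI impI conjI integrable_estimator(2) scale[OF bias_rate K(1)]
        scale[OF risk_rate K(2)] scale[OF variance_rate K(2)] scale[OF second_moment_rate K(3)])
qed

end
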